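(* Let $f:\mathcal{X}\to\mathbb{R}$ be a convex differentiable function on the open domain $\mathcal{X}$ that is closed (all sublevel sets $\{\mathbf{x}\in\mathcal{X}: f(\mathbf{x})\le a\}$, $a\in\mathbb{R}$, are closed), and suppose $f\in\mathcal{F}_{\ell}(\|\cdot\|)$ with $\ell$ sub-quadratic, i.e. $\lim_{\alpha\to\infty}\alpha^2/\ell(\alpha)=\infty$. Let $\mathbf{y}_0=\mathbf{x}_0=\operatorname{argmin}_{\mathbf{x}\in\mathcal{X}}\psi(\mathbf{x})$ and $$G:=\sup\{\alpha\in\mathbb{R}_+ : \alpha^2\le 2\ell(2\alpha)(f(\mathbf{x}_0)-f^* )\},\qquad L:=\ell(2G).$$ Let $0<\eta\le 1/(2L)$ and let the iterates be generated by mirror prox: for $t\in\mathbb{N}_+$, $$\mathbf{y}_t=\mathcal{P}_{\mathbf{x}_{t-1}}(\eta\nabla f(\mathbf{x}_{t-1})),\qquad \mathbf{x}_t=\mathcal{P}_{\mathbf{x}_{t-1}}(\eta\nabla f(\mathbf{y}_t)).$$ Then $\max\{\|\nabla f(\mathbf{y}_t)\|_*,\|\nabla f(\mathbf{x}_t)\|_*\}\le G$ for all $t\in\mathbb{N}$, and for every $T\in\mathbb{N}_+$, with $\overline{\mathbf{y}}_T=\frac1T\sum_{t=1}^T\mathbf{y}_t$, $$f(\overline{\mathbf{y}}_T)-f^*\le\frac{B(\mathbf{x}_*,\mathbf{x}_0)}{\eta T}.$$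
   Context: $\mathcal{E}$ is a finite-dimensional real Banach space with norm $\|\cdot\|$, dual space $\mathcal{E}^*$ and dual norm $\|\mathbf{u}\|_*:=\sup\{\langle\mathbf{u},\mathbf{y}\rangle:\|\mathbf{y}\|\le1\}$. $\mathcal{X}\subseteq\mathcal{E}$ is convex. $\mathbb{R}_+$ (resp. $\mathbb{R}_{++}$) is the set of nonnegative (resp. positive) reals; $\mathbb{N}$ includes $0$ and $\mathbb{N}_+$ is the set of positive integers. $\mathbf{x}_*\in\operatorname{argmin}_{\mathbf{x}\in\mathcal{X}}f(\mathbf{x})$ is a minimizer (assumed to exist) and $f^*=f(\mathbf{x}_* )$. $\ell*$-smoothness: for a non-decreasing continuous $\ell:\mathbb{R}_+\to\mathbb{R}_{++}$, a differentiable $f:\mathcal{X}\to\mathbb{R}$ belongs to $\mathcal{F}_\ell(\|\cdot\|)$ if for almost every $\mathbf{x}\in\mathcal{X}$: $\|\nabla^2f(\mathbf{x})\mathbf{h}\|_*\le\ell(\|\nabla f(\mathbf{x})\|_* )\|\mathbf{h}\|$ for all $\mathbf{h}\in\mathcal{X}$. Mirror map: $\psi:\mathcal{X}\to\mathbb{R}_+$ is a continuous distance-generating function: $\mathcal{X}^o=\{\mathbf{x}\in\mathcal{X}:\partial\psi(\mathbf{x})\ne\emptyset\}$ is convex, $\psi$ is continuously differentiable and $1$-strongly convex w.r.t. $\|\cdot\|$, i.e. $\langle\nabla\psi(\mathbf{x}_1)-\nabla\psi(\mathbf{x}_2),\mathbf{x}_1-\mathbf{x}_2\rangle\ge\|\mathbf{x}_1-\mathbf{x}_2\|^2$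 for $\mathbf{x}_1,\mathbf{x}_2\in\mathcal{X}^o$. Bregman function: $B(\mathbf{x},\mathbf{x}^o)=\psi(\mathbf{x})-\psi(\mathbf{x}^o)-\langle\nabla\psi(\mathbf{x}^o),\mathbf{x}-\mathbf{x}^o\rangle$ for $\mathbf{x}\in\mathcal{X},\mathbf{x}^o\in\mathcal{X}^o$. Prox-mapping: $\mathcal{P}_{\mathbf{y}}(\mathbf{g}):=\operatorname{argmin}_{\mathbf{x}\in\mathcal{X}}\{\langle\mathbf{g},\mathbf{x}\rangle+B(\mathbf{x},\mathbf{y})\}$; the argmins defining $\mathbf{x}_0$ and the iterates are assumed to be attained.
   Formalization: The gradient of f is additionally assumed locally Lipschitz (no uniform constant), and the Hessian bound is required for all directions h in E rather than only h in X; the claim fails without these, e.g. when f' is a continuous singular function. *)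

theory Defs
  imports "HOL-Analysis.Analysis"
begin

text \<open>
  The space is a type of class \<open>banach\<close> with a finite basis \<open>B\<close>; its dual is the type
  \<open>'a \<Rightarrow>\<^sub>L real\<close> of bounded linear functionals. The norm of that type is the dual norm:
\<close>

lemma norm_blinfun_eq_dual_norm:
  fixes u :: "'a::real_normed_vector \<Rightarrow>\<^sub>L real"
  shows "norm u = (SUP y\<in>cball 0 1. blinfun_apply u y)"
proof (rule antisym)
  have le: "blinfun_apply u y \<le> norm u" if "y \<in> cball 0 1" for y
  proof -
    have "blinfun_apply u y \<le> norm u * norm y"
      using norm_blinfun[of u y] by simp
    also have "\<dots> \<le> norm u * 1"
      using that by (intro mult_left_mono) auto
    finally show ?thesis by simp
  qed
  then have bdd: "bdd_above (blinfun_apply u ` cball 0 1)"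
    by (intro bdd_aboveI[where M = "norm u"]) blast
  show "(SUP y\<in>cball 0 1. blinfun_apply u y) \<le> norm u"
    using le by (intro cSUP_least) auto
  have up: "blinfun_apply u y \<le> (SUP y\<in>cball 0 1. blinfun_apply u y)" if "norm y \<le> 1" for y
    using that by (intro cSUP_upper bdd) auto
  show "norm u \<le> (SUP y\<in>cball 0 1. blinfun_apply u y)"
  proof (rule norm_blinfun_bound)
    show "0 \<le> (SUP y\<in>cball 0 1. blinfun_apply u y)"
      using up[of 0] by (simp add: blinfun.zero_right)
    fix x
    show "norm (blinfun_apply u x) \<le> (SUP y\<in>cball 0 1. blinfun_apply u y) * norm x"
    proof (cases "x = 0")
      case False
      define s where "s = sgn (blinfun_apply u x) / norm x"
      have "norm (s *\<^sub>R x) \<le> 1"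
        using False by (simp add: s_def abs_sgn_eq)
      from up[OF this] have "s * blinfun_apply u x \<le> (SUP y\<in>cball 0 1. blinfun_apply u y)"
        by (simp add: blinfun.scaleR_right)
      moreover have "s * blinfun_apply u x = \<bar>blinfun_apply u x\<bar> / norm x"
        by (simp add: s_def sgn_if)
      ultimately show ?thesis
        using False by (simp add: field_simps)
    qed (simp add: blinfun.zero_right)
  qed
qed

text \<open>
  Lebesgue-almost everywhere in a finite-dimensional space, expressed in the coordinates of a
  basis \<open>B\<close>. A change of basis is a linear isomorphism of the coordinate spaces, so the null sets
  do not depend on \<open>B\<close>. On Euclidean spaces this is how \<open>lborel\<close> is built.
\<close>

definition AE_lebesgue :: "'a::real_vector set \<Rightarrow> ('a \<Rightarrow> bool) \<Rightarrow> bool"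
  where "AE_lebesgue B P \<longleftrightarrow> (AE c in (\<Pi>\<^sub>M b\<in>B. lborel). P (\<Sum>b\<in>B. c b *\<^sub>R b))"

lemma AE_lebesgue_Basis:
  fixes P :: "'a::euclidean_space \<Rightarrow> bool"
  assumes "{x. P x} \<in> sets borel"
  shows "AE_lebesgue Basis P \<longleftrightarrow> (AE x in lborel. P x)"
  unfolding AE_lebesgue_def
  by (subst (2) lborel_eq, subst AE_distr_iff) (use assms in auto)

text \<open>Meaningful at points where \<open>f\<close> is differentiable.\<close>

definition grad :: "('a::real_normed_vector \<Rightarrow> real) \<Rightarrow> 'a \<Rightarrow> ('a \<Rightarrow>\<^sub>L real)"
  where "grad f x = Blinfun (frechet_derivative f (at x))"

lemma has_derivative_grad:
  assumes "f differentiable (at x)"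
  shows "(f has_derivative blinfun_apply (grad f x)) (at x)"
proof -
  have "(f has_derivative frechet_derivative f (at x)) (at x)"
    using assms by (simp add: frechet_derivative_works)
  then show ?thesis
    unfolding grad_def by (metis bounded_linear_Blinfun_apply has_derivative_bounded_linear)
qed

text \<open>
  The class \<open>F_ell\<close> of \<open>ell*\<close>-smooth functions on an open set \<open>X\<close>. The Hessian at \<open>x\<close> is the
  derivative \<open>H\<close> of the gradient map at \<open>x\<close>, a linear map into the dual space; the bound is
  required for all directions \<open>h\<close> of the space.

  For a condition on the almost-everywhere derivative of the gradient to say anything about
  the gradient itself, the gradient must be recoverable from that derivative: a function of one
  variable whose derivative is a Cantor-type function has zero second derivative almost
  everywhere. This is made explicit by taking the gradient to be locally Lipschitz.
  It holds automatically when \<open>f\<close> is twice continuously differentiable, and, in the presence of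
  the bound, when the Hessian is understood as a weak (Sobolev) derivative of the continuous
  gradient. No uniform Lipschitz constant is assumed.
\<close>

definition ell_smooth :: "'a::real_normed_vector set \<Rightarrow> 'a set \<Rightarrow> (real \<Rightarrow> real) \<Rightarrow> ('a \<Rightarrow> real) \<Rightarrow> bool"
  where "ell_smooth B X ell f \<longleftrightarrow>
    (\<forall>x\<in>X. f differentiable (at x)) \<and>
    (\<forall>x\<in>X. \<exists>r>0. \<exists>C. C-lipschitz_on (cball x r \<inter> X) (grad f)) \<and>
    AE_lebesgue B (\<lambda>x. x \<in> X \<longrightarrow>
      (\<exists>H. (grad f has_derivative H) (at x) \<and>
           (\<forall>h. norm (H h) \<le> ell (norm (grad f x)) * norm h)))"

definition subdifferential :: "'a::real_normed_vector set \<Rightarrow> ('a \<Rightarrow> real) \<Rightarrow> 'a \<Rightarrow> ('a \<Rightarrow>\<^sub>L real) set"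
  where "subdifferential X \<psi> x = {u. \<forall>z\<in>X. \<psi> x + blinfun_apply u (z - x) \<le> \<psi> z}"

definition subdiff_domain :: "'a::real_normed_vector set \<Rightarrow> ('a \<Rightarrow> real) \<Rightarrow> 'a set"
  where "subdiff_domain X \<psi> = {x\<in>X. subdifferential X \<psi> x \<noteq> {}}"

definition mirror_map :: "'a::real_normed_vector set \<Rightarrow> ('a \<Rightarrow> real) \<Rightarrow> bool"
  where "mirror_map X \<psi> \<longleftrightarrow>
    (\<forall>x\<in>X. 0 \<le> \<psi> x) \<and> continuous_on X \<psi> \<and>
    convex (subdiff_domain X \<psi>) \<and>
    (\<forall>x\<in>subdiff_domain X \<psi>. \<psi> differentiable (at x)) \<and>
    continuous_on (subdiff_domain X \<psi>) (grad \<psi>) \<and>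
    (\<forall>x\<in>subdiff_domain X \<psi>. \<forall>z\<in>subdiff_domain X \<psi>.
       blinfun_apply (grad \<psi> x - grad \<psi> z) (x - z) \<ge> (norm (x - z))\<^sup>2)"

definition bregman :: "('a::real_normed_vector \<Rightarrow> real) \<Rightarrow> 'a \<Rightarrow> 'a \<Rightarrow> real"
  where "bregman \<psi> x z = \<psi> x - \<psi> z - blinfun_apply (grad \<psi> z) (x - z)"

text \<open>
  The prox-mapping as the set of minimizers. It has at most one element for \<open>y\<close> in the
  subdifferential domain, since \<open>\<psi>\<close> is strongly convex there and every minimizer lies there.
\<close>

definition prox :: "'a::real_normed_vector set \<Rightarrow> ('a \<Rightarrow> real) \<Rightarrow> 'a \<Rightarrow> ('a \<Rightarrow>\<^sub>L real) \<Rightarrow> 'a set"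
  where "prox X \<psi> y g = {z. is_arg_min (\<lambda>x. blinfun_apply g x + bregman \<psi> x y) (\<lambda>x. x \<in> X) z}"

end

theory Submission
  imports Defs
begin

text \<open>
  Averaging the gradient over small boxes turns the almost-everywhere Hessian bound into a Lipschitz
  bound: if \<open>norm (grad f x) \<le> a\<close>, then \<open>grad f\<close> is \<open>ell (2 * a)\<close>-Lipschitz from \<open>x\<close> along segments
  shorter than \<open>a / ell (2 * a)\<close>. A step of that length in the steepest descent direction shows
  \<open>a\<^sup>2 \<le> 2 * ell (2 * a) * (f x - m)\<close> for \<open>a = norm (grad f x)\<close> and every lower bound \<open>m\<close> of \<open>f\<close>,
  so the gradient is bounded by \<open>G\<close> on the sublevel set of the starting point. Both half-steps of
  mirror prox have length at most \<open>\<eta> * G\<close> and do not increase \<open>f\<close>, hence never leave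
  this sublevel set, and the classical analysis with smoothness constant \<open>L\<close> applies.
\<close>

section \<open>From almost everywhere derivative bounds to Lipschitz bounds\<close>

text \<open>A segment is a null set, so an almost-everywhere Hessian bound says nothing about the
  gradient along any given segment; this is what forces the averaging. The local Lipschitz constants
  of the gradient are never quantitative: they give domination under the integral and a vanishing
  error as the box shrinks. The second obstacle is a circle: a smoothness constant needs a gradient
  bound, that bound is known only on a sublevel set, and staying there needs smoothness. It breaks
  because the radius \<open>a / ell (2 * a)\<close> depends on a bound for the gradient at the
  centre alone. With \<open>a = G\<close> this radius is \<open>G / L\<close>, while
  \<open>\<eta> \<le> 1 / (2 * L)\<close> limits each half-step to \<open>G / (2 * L)\<close>.
  Sub-quadratic growth is what makes \<open>G\<close> a finite bound.\<close>

text \<open>Bisection: the bound passes to unions of adjacent intervals, and a short interval around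
  \<open>s\<close> satisfies it by splitting at \<open>s\<close>. No derivative is required, so it
  serves both the averages, whose slope is known up to a small error, and the gradient with values
  in the dual space.\<close>

lemma local_slope_bound:
  fixes F :: "real \<Rightarrow> 'b::real_normed_vector"
  assumes ab: "a \<le> b"
    and slope: "\<And>s. a \<le> s \<Longrightarrow> s \<le> b \<Longrightarrow>
      \<exists>d>0. \<forall>t. a \<le> t \<longrightarrow> t \<le> b \<longrightarrow> \<bar>t - s\<bar> < d \<longrightarrow> norm (F t - F s) \<le> K * \<bar>t - s\<bar>"
  shows "norm (F b - F a) \<le> K * (b - a)"
proof -
  let ?P = "\<lambda>u v. a \<le> u \<longrightarrow> v \<le> b \<longrightarrow> norm (F v - F u) \<le> K * (v - u)"
  have "?P a b"
  proof (rule Bolzano[where P = ?P, OF ab])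
    fix u v w assume uv: "?P u v" and vw: "?P v w" and "u \<le> v" "v \<le> w"
    show "?P u w"
    proof (intro impI)
      assume "a \<le> u" "w \<le> b"
      then have "norm (F v - F u) \<le> K * (v - u)" "norm (F w - F v) \<le> K * (w - v)"
        using uv vw \<open>u \<le> v\<close> \<open>v \<le> w\<close> by auto
      moreover have "norm (F w - F u) \<le> norm (F w - F v) + norm (F v - F u)"
        using norm_triangle_ineq[of "F w - F v" "F v - F u"] by simp
      ultimately show "norm (F w - F u) \<le> K * (w - u)"
        by (simp add: algebra_simps)
    qed
  next
    fix s assume "a \<le> s" "s \<le> b"
    then obtain d where d: "d > 0"
      and *: "\<And>t. a \<le> t \<Longrightarrow> t \<le> b \<Longrightarrow> \<bar>t - s\<bar> < d \<Longrightarrow> norm (F t - F s) \<le> K * \<bar>t - s\<bar>"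
      using slope by blast
    show "\<exists>d>0. \<forall>u v. u \<le> s \<and> s \<le> v \<and> v - u < d \<longrightarrow> ?P u v"
    proof (intro exI[of _ d] conjI allI impI d)
      fix u v assume A: "u \<le> s \<and> s \<le> v \<and> v - u < d" "a \<le> u" "v \<le> b"
      then have "norm (F u - F s) \<le> K * \<bar>u - s\<bar>" "norm (F v - F s) \<le> K * \<bar>v - s\<bar>"
        using *[of u] *[of v] \<open>a \<le> s\<close> \<open>s \<le> b\<close> by auto
      moreover have "norm (F v - F u) \<le> norm (F v - F s) + norm (F u - F s)"
        using norm_triangle_ineq4[of "F v - F s" "F u - F s"] by simp
      ultimately show "norm (F v - F u) \<le> K * (v - u)"
        using A by (simp add: algebra_simps)
    qed
  qed
  then show ?thesis by simp
qed

section \<open>Basis coordinates: measurability and translation invariance\<close>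

definition comb :: "'a set \<Rightarrow> ('a \<Rightarrow> real) \<Rightarrow> 'a::real_vector"
  where "comb B c = (\<Sum>b\<in>B. c b *\<^sub>R b)"

lemma comb_surj:
  assumes "finite B" "span B = UNIV"
  obtains c where "c \<in> PiE B (\<lambda>_. UNIV)" "comb B c = w"
proof -
  have "w \<in> range (\<lambda>u. \<Sum>b\<in>B. u b *\<^sub>R b)"
    using assms span_finite[of B] by simp
  then obtain u where "w = (\<Sum>b\<in>B. u b *\<^sub>R b)"
    by blast
  then have "comb B (restrict u B) = w"
    by (simp add: comb_def)
  then show ?thesis using that[of "restrict u B"] by simp
qed

lemma norm_comb_diff_le:
  fixes B :: "'a::real_normed_vector set"
  assumes "\<And>b. b \<in> B \<Longrightarrow> \<bar>c b - d b\<bar> \<le> \<delta>"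
  shows "norm (comb B c - comb B d) \<le> \<delta> * (\<Sum>b\<in>B. norm b)"
proof -
  have "comb B c - comb B d = (\<Sum>b\<in>B. (c b - d b) *\<^sub>R b)"
    by (simp add: comb_def sum_subtractf scaleR_diff_left)
  also have "norm \<dots> \<le> (\<Sum>b\<in>B. \<delta> * norm b)"
    by (intro sum_norm_le) (use assms in \<open>auto intro!: mult_right_mono\<close>)
  finally show ?thesis by (simp add: sum_distrib_left)
qed

text \<open>
  The type of \<open>B\<close> need not be second countable, so measurability is obtained by rounding the
  coordinates to multiples of \<open>1 / Suc n\<close>, which leaves countably many coordinate vectors.
\<close>

lemma measurable_comb:
  fixes B :: "'a::real_normed_vector set" and g :: "'a \<Rightarrow> real"
  assumes B: "finite B" and g: "continuous_on UNIV g"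
  shows "(\<lambda>c. g (comb B c)) \<in> borel_measurable (\<Pi>\<^sub>M b\<in>B. lborel)"
proof -
  let ?M = "(\<Pi>\<^sub>M b\<in>B. lborel) :: ('a \<Rightarrow> real) measure"
  let ?r = "\<lambda>n c b. real_of_int \<lfloor>real (Suc n) * c b\<rfloor> / real (Suc n)"
  have "(\<lambda>c. g (comb B (?r n c))) \<in> borel_measurable ?M" for n
  proof -
    let ?fl = "\<lambda>c. \<lambda>b\<in>B. \<lfloor>real (Suc n) * c b\<rfloor>"
    let ?C = "(\<Pi>\<^sub>M b\<in>B. count_space UNIV) :: ('a \<Rightarrow> int) measure"
    have "?fl \<in> measurable ?M ?C"
    proof (rule measurable_restrict)
      fix b assume "b \<in> B"
      then have "(\<lambda>c. real (Suc n) * c b) \<in> borel_measurable ?M"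
        using measurable_component_singleton[of b B "\<lambda>_. lborel"] by simp
      then show "(\<lambda>c. \<lfloor>real (Suc n) * c b\<rfloor>) \<in> measurable ?M (count_space UNIV)"
        by (rule measurable_compose) simp
    qed
    \<comment> \<open>For a finite index set and countable factors the product sigma-algebra is
      discrete, so every function of the rounded coordinates is measurable.\<close>
    moreover have "?C = count_space (PiE B (\<lambda>_. UNIV))"
      by (rule count_space_PiM_finite) (use B in auto)
    ultimately have "?fl \<in> measurable ?M (count_space (PiE B (\<lambda>_. UNIV)))"
      by simp
    then have "(\<lambda>c. g (comb B (\<lambda>b. real_of_int (?fl c b) / real (Suc n)))) \<in> borel_measurable ?M"
      by (rule measurable_compose) simp
    moreover have "comb B (\<lambda>b. real_of_int (?fl c b) / real (Suc n)) = comb B (?r n c)" for c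
      by (simp add: comb_def)
    ultimately show ?thesis by simp
  qed
  note meas = this
  have lim: "(\<lambda>n. g (comb B (?r n c))) \<longlonglongrightarrow> g (comb B c)" for c
  proof -
    have "(\<lambda>n. inverse (real (Suc n)) * (\<Sum>b\<in>B. norm b)) \<longlonglongrightarrow> 0"
      by (rule tendsto_mult_left_zero[OF LIMSEQ_inverse_real_of_nat])
    note null = this
    have bound: "norm (comb B (?r n c) - comb B c) \<le> inverse (real (Suc n)) * (\<Sum>b\<in>B. norm b)" for n
    proof (rule norm_comb_diff_le)
      fix b
      have "\<bar>real_of_int \<lfloor>real (Suc n) * c b\<rfloor> - real (Suc n) * c b\<bar> \<le> 1"
        by linarith
      then have "\<bar>real_of_int \<lfloor>real (Suc n) * c b\<rfloor> - real (Suc n) * c b\<bar> / real (Suc n) \<le> 1 / real (Suc n)"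
        by (intro divide_right_mono) auto
      moreover have "\<bar>?r n c b - c b\<bar> = \<bar>(real_of_int \<lfloor>real (Suc n) * c b\<rfloor> - real (Suc n) * c b) / real (Suc n)\<bar>"
        by (simp add: diff_divide_distrib del: of_nat_Suc)
      ultimately show "\<bar>?r n c b - c b\<bar> \<le> inverse (real (Suc n))"
        by (simp add: abs_divide inverse_eq_divide del: of_nat_Suc)
    qed
    have "(\<lambda>n. comb B (?r n c) - comb B c) \<longlonglongrightarrow> 0"
      by (rule Lim_null_comparison[OF always_eventually null]) (use bound in blast)
    then have "(\<lambda>n. comb B (?r n c)) \<longlonglongrightarrow> comb B c"
      by (simp add: LIM_zero_iff)
    then show ?thesis
      by (rule continuous_on_tendsto_compose[OF g]) auto
  qed
  show ?thesis
    by (rule borel_measurable_LIMSEQ_real[OF lim meas])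
qed

text \<open>Multiplication by \<open>cut n\<close> turns the zero extension of \<open>g\<close> into
  a continuous function on the whole space, and pointwise limits keep measurability.\<close>

lemma measurable_comb_ball:
  fixes B :: "'a::real_normed_vector set" and g :: "'a \<Rightarrow> real"
  assumes B: "finite B" and g: "continuous_on (ball z r) g"
  shows "(\<lambda>c. if comb B c \<in> ball z r then g (comb B c) else 0) \<in> borel_measurable (\<Pi>\<^sub>M b\<in>B. lborel)"
proof -
  let ?M = "(\<Pi>\<^sub>M b\<in>B. lborel) :: ('a \<Rightarrow> real) measure"
  \<comment> \<open>The shift by \<open>1\<close> makes \<open>cut n\<close> vanish where
    \<open>r - dist z w < 1 / Suc n\<close>, an open set that covers the space together with the
    ball, so continuity can be glued. Inside the ball the factor is \<open>1\<close> once
    \<open>Suc n * (r - dist z w) \<ge> 2\<close>.\<close>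
  define cut where "cut n w = min 1 (max 0 (real (Suc n) * (r - dist z w) - 1))" for n w
  define k where "k n w = (if w \<in> ball z r then g w else 0) * cut n w" for n w
  have "continuous_on UNIV (k n)" for n
  proof -
    let ?V = "{w. r - 1 / real (Suc n) < dist z w}"
    have V: "open ?V"
      by (intro open_Collect_less continuous_intros)
    have "continuous_on (ball z r) (\<lambda>w. g w * cut n w)"
      unfolding cut_def by (intro continuous_intros g)
    then have "continuous_on (ball z r) (k n)"
      by (rule continuous_on_eq) (simp add: k_def)
    moreover have "continuous_on ?V (k n)"
    proof (rule continuous_on_eq[OF continuous_on_const[of _ 0]])
      fix w assume "w \<in> ?V"
      then have "real (Suc n) * (r - dist z w) < 1"
        by (simp add: field_simps)
      then show "0 = k n w" by (simp add: k_def cut_def)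
    qed
    ultimately have "continuous_on (ball z r \<union> ?V) (k n)"
      using V by (intro continuous_on_open_Un) auto
    moreover have "ball z r \<union> ?V = UNIV"
    proof -
      have "w \<in> ?V" if "w \<notin> ball z r" for w
      proof -
        have "0 < 1 / real (Suc n)" by simp
        with that show ?thesis unfolding mem_Collect_eq mem_ball by linarith
      qed
      then show ?thesis by blast
    qed
    ultimately show ?thesis by simp
  qed
  then have "(\<lambda>c. k n (comb B c)) \<in> borel_measurable ?M" for n
    by (rule measurable_comb[OF B])
  note meas = this
  have lim: "(\<lambda>n. k n w) \<longlonglongrightarrow> (if w \<in> ball z r then g w else 0)" for w
  proof (cases "w \<in> ball z r")
    case True
    then have "filterlim (\<lambda>n. real (Suc n) * (r - dist z w)) at_top sequentially"
      by (intro filterlim_at_top_mult_tendsto_pos[OF tendsto_const] filterlim_compose[OF filterlim_real_sequentially filterlim_Suc])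
         auto
    then have "eventually (\<lambda>n. 2 \<le> real (Suc n) * (r - dist z w)) sequentially"
      by (auto simp: filterlim_at_top)
    then have "eventually (\<lambda>n. k n w = g w) sequentially"
      by eventually_elim (use True in \<open>simp add: k_def cut_def\<close>)
    then show ?thesis using True by (simp add: tendsto_eventually)
  qed (simp add: k_def)
  show ?thesis
    by (rule borel_measurable_LIMSEQ_real[OF lim meas])
qed

text \<open>Translation leaves the measure of each side of a product set unchanged, and product sets
  determine the measure. The restriction to \<open>B\<close> keeps the translated vector in the
  space of the product. This carries the exceptional null set along with a moving box.\<close>

lemma AE_PiM_lborel_translate:
  assumes B: "finite B"
    and AE: "AE c in (\<Pi>\<^sub>M b\<in>B. lborel). P c"
  shows "AE c in (\<Pi>\<^sub>M b\<in>B. lborel). P (\<lambda>b\<in>B. c b + e b :: real)"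
proof -
  let ?M = "(\<Pi>\<^sub>M b\<in>B. lborel) :: ('a \<Rightarrow> real) measure"
  interpret product_sigma_finite "\<lambda>b::'a. lborel :: real measure" ..
  let ?T = "\<lambda>c. \<lambda>b\<in>B. c b + e b"
  have T: "?T \<in> measurable ?M ?M"
    by (intro measurable_restrict) simp
  have "distr ?M ?M ?T = ?M"
  proof (rule PiM_eqI[OF B])
    fix A :: "'a \<Rightarrow> real set" assume A: "\<And>b. b \<in> B \<Longrightarrow> A b \<in> sets lborel"
    have "?T -` Pi\<^sub>E B A \<inter> space ?M = Pi\<^sub>E B (\<lambda>b. (\<lambda>x. x + e b) -` A b)"
      by (auto simp: space_PiM PiE_iff Pi_iff extensional_def)
    moreover have "emeasure lborel ((\<lambda>x. x + e b) -` A b) = emeasure lborel (A b)" if "b \<in> B" for b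
    proof -
      have eq: "(\<lambda>x. x + e b) = (+) (e b)"
        by (auto simp: fun_eq_iff)
      have "emeasure (distr lborel borel ((+) (e b))) (A b) = emeasure lborel (((+) (e b)) -` A b)"
        using A[OF that] by (subst emeasure_distr) auto
      then show ?thesis by (simp add: lborel_distr_plus eq)
    qed
    moreover have "(\<lambda>x. x + e b) -` A b \<in> sets lborel" if "b \<in> B" for b
    proof -
      have "(\<lambda>x. x + e b) -` A b \<inter> space lborel \<in> sets lborel"
        using A[OF that] by (intro measurable_sets[where A = borel]) auto
      then show ?thesis by simp
    qed
    ultimately show "emeasure (distr ?M ?M ?T) (Pi\<^sub>E B A) = (\<Prod>b\<in>B. emeasure lborel (A b))"
      using A B by (subst emeasure_distr[OF T]) (auto simp: emeasure_PiM intro!: sets_PiM_I_finite)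
  qed simp
  then have "AE c in distr ?M ?M ?T. P c" using AE by (simp only:)
  then show ?thesis by (rule AE_distrD[OF T])
qed

lemma comb_translate: "comb B (\<lambda>b\<in>B. c b + e b) = comb B c + comb B e"
  by (simp add: comb_def scaleR_add_left sum.distrib)

lemma box_PiM_lborel:
  assumes B: "finite B" and "0 < \<delta>"
  shows "(\<Pi>\<^sub>E b\<in>B. {d b - \<delta><..<d b + \<delta>}) \<in> sets (\<Pi>\<^sub>M b\<in>B. lborel)"
    and "emeasure (\<Pi>\<^sub>M b\<in>B. lborel) (\<Pi>\<^sub>E b\<in>B. {d b - \<delta><..<d b + \<delta>}) = ennreal ((2 * \<delta>) ^ card B)"
proof -
  interpret product_sigma_finite "\<lambda>b. lborel :: real measure" ..
  show "(\<Pi>\<^sub>E b\<in>B. {d b - \<delta><..<d b + \<delta>}) \<in> sets (\<Pi>\<^sub>M b\<in>B. lborel)"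
    using B by (intro sets_PiM_I_finite) auto
  show "emeasure (\<Pi>\<^sub>M b\<in>B. lborel) (\<Pi>\<^sub>E b\<in>B. {d b - \<delta><..<d b + \<delta>}) = ennreal ((2 * \<delta>) ^ card B)"
    using assms by (subst emeasure_PiM) (auto simp: prod_ennreal ennreal_power)
qed

text \<open>
  The average \<open>F s\<close> of \<open>g\<close> over a small coordinate box translated by \<open>s *\<^sub>R (z2 - z1)\<close> does not see
  null sets: by dominated convergence its slope is at most \<open>K * norm (z2 - z1)\<close> times the volume
  of the box. The difference \<open>g z2 - g z1\<close> is recovered as the box shrinks.
\<close>

lemma lipschitz_diff_le_of_AE_deriv:
  fixes B :: "'a::real_normed_vector set" and g :: "'a \<Rightarrow> real"
  assumes B: "finite B" "span B = UNIV"
    and g: "C-lipschitz_on (ball z \<rho>) g"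
    and K: "0 \<le> K"
    and AE: "AE_lebesgue B (\<lambda>w. w \<in> ball z \<rho> \<longrightarrow>
      (\<exists>H. (g has_derivative H) (at w) \<and> (\<forall>h. \<bar>H h\<bar> \<le> K * norm h)))"
    and z1: "z1 \<in> ball z \<rho>" and z2: "z2 \<in> ball z \<rho>"
  shows "g z2 - g z1 \<le> K * norm (z2 - z1)"
proof (rule field_le_epsilon)
  fix e :: real assume "0 < e"
  let ?M = "(\<Pi>\<^sub>M b\<in>B. lborel) :: ('a \<Rightarrow> real) measure"
  define h where "h = z2 - z1"
  have C: "0 \<le> C" using g by (rule lipschitz_on_nonneg)
  have gC: "\<bar>g u - g v\<bar> \<le> C * norm (u - v)" if "u \<in> ball z \<rho>" "v \<in> ball z \<rho>" for u v
    using lipschitz_onD[OF g that] by (simp add: dist_real_def dist_norm)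
  \<comment> \<open>The first bound keeps every translate of the \<open>r\<close>-ball around
    \<open>z1\<close> inside the large ball; the second makes moving both endpoints by
    \<open>r\<close> cost at most \<open>2 * C * r \<le> e\<close>. The \<open>+ 1\<close> covers
    \<open>C = 0\<close>.\<close>
  define r where "r = min (\<rho> - max (dist z z1) (dist z z2)) (e / (2 * C + 1))"
  have r: "0 < r" "2 * C * r \<le> e"
  proof -
    show "0 < r" using z1 z2 \<open>0 < e\<close> C by (simp add: r_def)
    have "r \<le> e / (2 * C + 1)" by (simp add: r_def)
    then have "r * (2 * C + 1) \<le> e" using C by (simp add: pos_le_divide_eq)
    then show "2 * C * r \<le> e" using \<open>0 < r\<close> by (simp add: algebra_simps)
  qed
  have shift: "w + s *\<^sub>R h \<in> ball z \<rho>" if "dist z1 w < r" "0 \<le> s" "s \<le> 1" for w s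
  proof -
    have "z - (w + s *\<^sub>R h) = (1 - s) *\<^sub>R (z - z1) + s *\<^sub>R (z - z2) + (z1 - w)"
      by (simp add: h_def algebra_simps)
    also have "norm \<dots> \<le> (1 - s) * dist z z1 + s * dist z z2 + dist z1 w"
      using that by (intro order_trans[OF norm_triangle_ineq] add_mono) (auto simp: dist_norm)
    also have "(1 - s) * dist z z1 + s * dist z z2 \<le> max (dist z z1) (dist z z2)"
      using that by (intro convex_bound_le) auto
    also have "max (dist z z1) (dist z z2) + dist z1 w < \<rho>"
      using that by (simp add: r_def)
    finally show ?thesis by (simp add: dist_norm)
  qed
  obtain d where d: "comb B d = z1" using comb_surj[OF B, of z1] by blast
  define \<delta> where "\<delta> = r / ((\<Sum>b\<in>B. norm b) + 1)"
  have S: "0 \<le> (\<Sum>b\<in>B. norm b)" by (intro sum_nonneg) auto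
  have \<delta>: "0 < \<delta>" "\<delta> * (\<Sum>b\<in>B. norm b) < r"
    using r S by (auto simp: \<delta>_def field_simps)
  define Q where "Q = (\<Pi>\<^sub>E b\<in>B. {d b - \<delta><..<d b + \<delta>})"
  define m where "m = (2 * \<delta>) ^ card B"
  have m: "0 < m" using \<delta> by (simp add: m_def)
  have Q[measurable]: "Q \<in> sets ?M" and eQ: "emeasure ?M Q = ennreal m"
    using box_PiM_lborel[OF B(1) \<delta>(1)] by (auto simp: Q_def m_def)
  have mQ: "measure ?M Q = m"
    using eQ m by (simp add: measure_def)
  have near: "dist z1 (comb B c) < r" if "c \<in> Q" for c
  proof -
    have "norm (comb B c - comb B d) \<le> \<delta> * (\<Sum>b\<in>B. norm b)"
      using that by (intro norm_comb_diff_le) (force simp: Q_def PiE_iff abs_le_iff)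
    then show ?thesis using \<delta> by (simp add: d dist_norm norm_minus_commute)
  qed
  \<comment> \<open>The default \<open>0\<close> makes the integrand measurable on the whole
    coordinate space; points of the box never meet it for \<open>s\<close> between \<open>0\<close>
    and \<open>1\<close>.\<close>
  define \<Phi> where "\<Phi> s c = (if comb B c + s *\<^sub>R h \<in> ball z \<rho> then g (comb B c + s *\<^sub>R h) else 0)" for s c
  have \<Phi>: "\<Phi> s c = g (comb B c + s *\<^sub>R h)" if "c \<in> Q" "0 \<le> s" "s \<le> 1" for s c
    using shift[OF near] that by (simp add: \<Phi>_def)
  have [measurable]: "\<Phi> s \<in> borel_measurable ?M" for s
  proof -
    have eq: "w \<in> ball (z - s *\<^sub>R h) \<rho> \<longleftrightarrow> w + s *\<^sub>R h \<in> ball z \<rho>" for w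
      by (simp add: dist_norm algebra_simps)
    have "continuous_on (ball (z - s *\<^sub>R h) \<rho>) (\<lambda>w. g (w + s *\<^sub>R h))"
      by (rule continuous_on_compose2[OF lipschitz_on_continuous_on[OF g]])
        (auto intro!: continuous_intros simp only: eq)
    from measurable_comb_ball[OF B(1) this] show ?thesis
      by (simp only: eq \<Phi>_def[abs_def])
  qed
  define F where "F s = (\<integral>c. indicator Q c * \<Phi> s c \<partial>?M)" for s
  have int: "integrable ?M (\<lambda>c. indicator Q c * u c)"
    if [measurable]: "u \<in> borel_measurable ?M" and "\<And>c. c \<in> Q \<Longrightarrow> \<bar>u c\<bar> \<le> b" for u :: "('a \<Rightarrow> real) \<Rightarrow> real" and b :: real
    using that(2) eQ by (intro integrableI_bounded_set[where A = Q and B = b]) auto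
  have int\<Phi>: "integrable ?M (\<lambda>c. indicator Q c * \<Phi> s c)" if s: "0 \<le> s" "s \<le> 1" for s
  proof (rule int[where b = "\<bar>g z1\<bar> + C * (2 * \<rho>)"])
    fix c assume c: "c \<in> Q"
    have w: "comb B c + s *\<^sub>R h \<in> ball z \<rho>" using shift near c s by blast
    have "norm (comb B c + s *\<^sub>R h - z1) \<le> 2 * \<rho>"
      using w z1 dist_triangle[of "comb B c + s *\<^sub>R h" z1 z]
      by (simp add: dist_norm norm_minus_commute)
    then have "C * norm (comb B c + s *\<^sub>R h - z1) \<le> C * (2 * \<rho>)"
      by (rule mult_left_mono[OF _ C])
    then show "\<bar>\<Phi> s c\<bar> \<le> \<bar>g z1\<bar> + C * (2 * \<rho>)"
      using gC[OF w z1] \<Phi>[OF c s] by linarith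
  qed simp
  have iQ: "integrable ?M (indicat_real Q)"
    using int[of "\<lambda>_. 1" 1] by simp
  have intQ: "(\<integral>c. indicator Q c * a \<partial>?M) = a * m" for a :: real
    using mQ by simp
  have slope: "\<exists>\<tau>>0. \<forall>t. 0 \<le> t \<longrightarrow> t \<le> 1 \<longrightarrow> \<bar>t - s\<bar> < \<tau> \<longrightarrow>
      norm (F t - F s) \<le> ((K * norm h + \<epsilon>) * m) * \<bar>t - s\<bar>"
    if s: "0 \<le> s" "s \<le> 1" and \<epsilon>: "0 < \<epsilon>" for s \<epsilon>
  proof -
    \<comment> \<open>The excess of the difference quotient over the desired slope: bounded by
      \<open>C * norm h\<close> on the box, and tending to \<open>0\<close> wherever the derivative
      bound holds, so dominated convergence applies.\<close>
    define U where "U t c = max 0 (\<bar>\<Phi> t c - \<Phi> s c\<bar> / \<bar>t - s\<bar> - K * norm h)" for t c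
    have [measurable]: "U t \<in> borel_measurable ?M" for t
      unfolding U_def by measurable
    have \<Phi>C: "\<bar>\<Phi> t c - \<Phi> s c\<bar> \<le> C * norm h * \<bar>t - s\<bar>" if "c \<in> Q" "0 \<le> t" "t \<le> 1" for t c
      using gC[OF shift[OF near[OF that(1)] that(2,3)] shift[OF near[OF that(1)] s]] that s
      by (simp add: \<Phi> mult.assoc mult.commute[of "norm h"] flip: scaleR_diff_left)
    have Ub: "\<bar>U t c\<bar> \<le> C * norm h" if "c \<in> Q" "0 \<le> t" "t \<le> 1" "t \<noteq> s" for t c
    proof -
      have "\<bar>\<Phi> t c - \<Phi> s c\<bar> / \<bar>t - s\<bar> \<le> C * norm h"
        using \<Phi>C[OF that(1-3)] that(4) by (simp add: pos_divide_le_eq)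
      moreover have "0 \<le> K * norm h" "0 \<le> C * norm h" using K C by auto
      ultimately show ?thesis unfolding U_def by linarith
    qed
    \<comment> \<open>The null set may depend on \<open>s\<close>. This is harmless, because
      \<open>s\<close> is fixed before integrating.\<close>
    have AEs: "AE c in ?M. c \<in> Q \<longrightarrow> ((\<lambda>t. U t c) \<longlongrightarrow> 0) (at s within {0..1})"
    proof -
      obtain e0 where e0: "comb B e0 = s *\<^sub>R h" using comb_surj[OF B, of "s *\<^sub>R h"] by blast
      have "AE c in ?M. comb B c + s *\<^sub>R h \<in> ball z \<rho> \<longrightarrow>
          (\<exists>H. (g has_derivative H) (at (comb B c + s *\<^sub>R h)) \<and> (\<forall>h. \<bar>H h\<bar> \<le> K * norm h))"
        using AE_PiM_lborel_translate[OF B(1) AE[unfolded AE_lebesgue_def, folded comb_def], of e0]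
        by (simp only: comb_translate e0)
      then show ?thesis
      proof eventually_elim
        case (elim c)
        show ?case
        proof
          assume c: "c \<in> Q"
          let ?w = "comb B c + s *\<^sub>R h"
          obtain H where H: "(g has_derivative H) (at ?w)" and HK: "\<And>h. \<bar>H h\<bar> \<le> K * norm h"
            using elim shift[OF near[OF c] s] by blast
          have "((\<lambda>t. comb B c + t *\<^sub>R h) has_derivative (\<lambda>t. t *\<^sub>R h)) (at s within {0..1})"
            by (auto intro!: derivative_eq_intros)
          from has_derivative_compose[OF this H]
          have "((\<lambda>t. g (comb B c + t *\<^sub>R h)) has_derivative (\<lambda>t. H (t *\<^sub>R h))) (at s within {0..1})" .
          moreover have "H (t *\<^sub>R h) = H h * t" for t
            using has_derivative_bounded_linear[OF H]
            by (simp add: linear_cmul bounded_linear.linear)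
          ultimately have "((\<lambda>t. g (comb B c + t *\<^sub>R h)) has_field_derivative H h) (at s within {0..1})"
            by (simp add: has_field_derivative_def)
          then have "((\<lambda>t. (g (comb B c + t *\<^sub>R h) - g (comb B c + s *\<^sub>R h)) / (t - s)) \<longlongrightarrow> H h) (at s within {0..1})"
            by (simp add: has_field_derivative_iff)
          then have lim: "((\<lambda>t. max 0 (\<bar>(g (comb B c + t *\<^sub>R h) - g (comb B c + s *\<^sub>R h)) / (t - s)\<bar> - K * norm h))
              \<longlongrightarrow> max 0 (\<bar>H h\<bar> - K * norm h)) (at s within {0..1})"
            by (intro tendsto_intros)
          have lim0: "max 0 (\<bar>H h\<bar> - K * norm h) = 0"
            using HK[of h] by simp
          have ev: "\<forall>\<^sub>F t in at s within {0..1}.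
              max 0 (\<bar>(g (comb B c + t *\<^sub>R h) - g (comb B c + s *\<^sub>R h)) / (t - s)\<bar> - K * norm h) = U t c"
            unfolding eventually_at_filter
            by (intro always_eventually) (use c s in \<open>auto simp: U_def \<Phi> abs_divide\<close>)
          show "((\<lambda>t. U t c) \<longlongrightarrow> 0) (at s within {0..1})"
            by (rule Lim_transform_eventually[OF lim[unfolded lim0] ev])
        qed
      qed
    qed
    have "((\<lambda>t. \<integral>c. indicator Q c * U t c \<partial>?M) \<longlongrightarrow> 0) (at s within {0..1})"
      unfolding tendsto_at_iff_sequentially o_def
    proof (intro allI impI)
      fix X :: "nat \<Rightarrow> real" assume X: "\<forall>i. X i \<in> {0..1} - {s}" and Xs: "X \<longlonglongrightarrow> s"
      have "(\<lambda>i. \<integral>c. indicator Q c * U (X i) c \<partial>?M) \<longlonglongrightarrow> (\<integral>c. 0 \<partial>?M)"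
      proof (rule integral_dominated_convergence[where w = "\<lambda>c. indicator Q c * (C * norm h)"])
        show "integrable ?M (\<lambda>c. indicator Q c * (C * norm h))"
          by (rule int[where b = "\<bar>C * norm h\<bar>"]) auto
        show "AE c in ?M. (\<lambda>i. indicator Q c * U (X i) c) \<longlonglongrightarrow> 0"
          using AEs
        proof eventually_elim
          case (elim c)
          then show ?case
            using X Xs by (cases "c \<in> Q") (auto simp: tendsto_at_iff_sequentially o_def)
        qed
        show "AE c in ?M. norm (indicator Q c * U (X i) c) \<le> indicator Q c * (C * norm h)" for i
          using X Ub by (intro AE_I2) (auto simp: indicator_def)
      qed auto
      then show "(\<lambda>i. \<integral>c. indicator Q c * U (X i) c \<partial>?M) \<longlonglongrightarrow> 0" by simp
    qed
    then have "\<forall>\<^sub>F t in at s within {0..1}. (\<integral>c. indicator Q c * U t c \<partial>?M) < \<epsilon> * m"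
      using \<epsilon> m by (intro order_tendstoD) auto
    then obtain \<tau> where \<tau>: "\<tau> > 0"
      and small: "\<And>t. t \<in> {0..1} \<Longrightarrow> t \<noteq> s \<Longrightarrow> dist t s < \<tau> \<Longrightarrow> (\<integral>c. indicator Q c * U t c \<partial>?M) < \<epsilon> * m"
      unfolding eventually_at by blast
    show ?thesis
    proof (intro exI[of _ \<tau>] conjI allI impI \<tau>)
      fix t assume t: "0 \<le> t" "t \<le> 1" "\<bar>t - s\<bar> < \<tau>"
      show "norm (F t - F s) \<le> ((K * norm h + \<epsilon>) * m) * \<bar>t - s\<bar>"
      proof (cases "t = s")
        case False
        let ?D = "\<lambda>c. indicator Q c * (\<Phi> t c - \<Phi> s c)"
        have D: "?D = (\<lambda>c. indicator Q c * \<Phi> t c - indicator Q c * \<Phi> s c)"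
          by (simp add: algebra_simps)
        have iD: "integrable ?M ?D"
          unfolding D using int\<Phi> t s by (intro Bochner_Integration.integrable_diff) auto
        have iU: "integrable ?M (\<lambda>c. indicator Q c * U t c)"
          using Ub t False by (intro int[where b = "C * norm h"]) auto
        have "F t - F s = (\<integral>c. ?D c \<partial>?M)"
          unfolding F_def D using int\<Phi> t s by simp
        also have "norm \<dots> \<le> (\<integral>c. norm (?D c) \<partial>?M)"
          by (rule integral_norm_bound)
        also have "\<dots> \<le> (\<integral>c. \<bar>t - s\<bar> * (indicator Q c * (K * norm h) + indicator Q c * U t c) \<partial>?M)"
        proof (rule integral_mono)
          show "integrable ?M (\<lambda>c. norm (?D c))"
            by (rule integrable_norm[OF iD])
          have "integrable ?M (\<lambda>c. indicator Q c * (K * norm h))"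
            by (rule int[where b = "\<bar>K * norm h\<bar>"]) auto
          with iU show "integrable ?M (\<lambda>c. \<bar>t - s\<bar> * (indicator Q c * (K * norm h) + indicator Q c * U t c))"
            by (intro integrable_mult_right Bochner_Integration.integrable_add)
          fix c
          have "\<bar>\<Phi> t c - \<Phi> s c\<bar> / \<bar>t - s\<bar> \<le> K * norm h + U t c"
            by (simp add: U_def)
          then have "\<bar>\<Phi> t c - \<Phi> s c\<bar> \<le> \<bar>t - s\<bar> * (K * norm h + U t c)"
            using False by (simp add: pos_divide_le_eq mult.commute)
          then show "norm (?D c) \<le> \<bar>t - s\<bar> * (indicator Q c * (K * norm h) + indicator Q c * U t c)"
            by (auto simp: indicator_def)
        qed
        also have "\<dots> = \<bar>t - s\<bar> * (K * norm h * m + (\<integral>c. indicator Q c * U t c \<partial>?M))"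
          using iU iQ by (simp add: mQ)
        also have "\<dots> \<le> \<bar>t - s\<bar> * (K * norm h * m + \<epsilon> * m)"
          using small[of t] t False by (intro mult_left_mono add_left_mono) (auto simp: dist_real_def)
        finally show ?thesis by (simp add: algebra_simps)
      qed simp
    qed
  qed
  have "F 1 - F 0 \<le> K * norm h * m"
  proof (rule field_le_epsilon)
    fix \<epsilon> :: real assume "0 < \<epsilon>"
    then have "0 < \<epsilon> / m" using m by simp
    then have "norm (F 1 - F 0) \<le> ((K * norm h + \<epsilon> / m) * m) * (1 - 0)"
      by (intro local_slope_bound slope) auto
    then show "F 1 - F 0 \<le> K * norm h * m + \<epsilon>"
      using m by (simp add: algebra_simps)
  qed
  \<comment> \<open>For \<open>c\<close> in the box, \<open>comb B c\<close> and
    \<open>comb B c + h\<close> lie within \<open>r\<close> of \<open>z1\<close> and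
    \<open>z2\<close>, so each endpoint costs at most \<open>C * r\<close>.\<close>
  moreover have "(g z2 - g z1 - e) * m \<le> F 1 - F 0"
  proof -
    have "(g z2 - g z1 - e) * m = (\<integral>c. indicator Q c * (g z2 - g z1 - e) \<partial>?M)"
      by (simp only: intQ)
    also have "\<dots> \<le> (\<integral>c. indicator Q c * \<Phi> 1 c - indicator Q c * \<Phi> 0 c \<partial>?M)"
    proof (rule integral_mono)
      show "integrable ?M (\<lambda>c. indicator Q c * (g z2 - g z1 - e))"
        by (rule int[where b = "\<bar>g z2 - g z1 - e\<bar>"]) auto
      show "integrable ?M (\<lambda>c. indicator Q c * \<Phi> 1 c - indicator Q c * \<Phi> 0 c)"
        using int\<Phi> by (intro Bochner_Integration.integrable_diff) auto
      fix c
      show "indicator Q c * (g z2 - g z1 - e) \<le> indicator Q c * \<Phi> 1 c - indicator Q c * \<Phi> 0 c"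
      proof (cases "c \<in> Q")
        case True
        let ?w = "comb B c"
        have w: "?w \<in> ball z \<rho>" "?w + h \<in> ball z \<rho>"
          using shift[OF near[OF True], of 0] shift[OF near[OF True], of 1] by auto
        have "C * norm (z1 - ?w) \<le> C * r"
          using near[OF True] C by (intro mult_left_mono) (auto simp: dist_norm)
        moreover have "\<bar>g z2 - g (?w + h)\<bar> \<le> C * norm (z1 - ?w)"
          using gC[OF z2 w(2)] by (simp add: h_def algebra_simps)
        moreover have "\<bar>g z1 - g ?w\<bar> \<le> C * norm (z1 - ?w)"
          using gC[OF z1 w(1)] .
        ultimately have "g z2 - g z1 - e \<le> g (?w + h) - g ?w"
          using r(2) by linarith
        then show ?thesis using True by (simp add: \<Phi>)
      qed simp
    qed
    also have "\<dots> = F 1 - F 0"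
      unfolding F_def using int\<Phi> by simp
    finally show ?thesis .
  qed
  ultimately have "(g z2 - g z1 - e) * m \<le> K * norm h * m" by simp
  then show "g z2 - g z1 \<le> K * norm (z2 - z1) + e"
    using m by (simp add: h_def)
qed

lemma AE_lebesgue_mono:
  assumes "AE_lebesgue B P" "\<And>x. P x \<Longrightarrow> Q x"
  shows "AE_lebesgue B Q"
  using assms unfolding AE_lebesgue_def by (auto elim: eventually_mono)

section \<open>Generalized smoothness along segments\<close>

text \<open>Supplies the first exit time in the two continuity arguments below.\<close>

lemma closed_attains_least:
  fixes S :: "real set"
  assumes "closed S" "S \<subseteq> {a..b}" "S \<noteq> {}"
  shows "\<exists>t\<in>S. \<forall>s\<in>S. t \<le> s"
proof -
  have "compact S"
    using assms bounded_subset[OF bounded_closed_interval] by (auto simp: compact_eq_bounded_closed)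
  then show ?thesis using compact_attains_inf[OF _ assms(3)] by blast
qed

text \<open>Along the segment, \<open>f\<close> minus its quadratic majorant has non-positive
  derivative. Only gradient differences against the fixed point \<open>x\<close> enter, which is the
  form that \<open>grad_near\<close> provides.\<close>

lemma descent_of_grad_bound:
  fixes f :: "'a::real_normed_vector \<Rightarrow> real"
  assumes diff: "\<And>s. 0 \<le> s \<Longrightarrow> s \<le> 1 \<Longrightarrow> f differentiable at (x + s *\<^sub>R (y - x))"
    and bound: "\<And>s. 0 \<le> s \<Longrightarrow> s \<le> 1 \<Longrightarrow>
      norm (grad f (x + s *\<^sub>R (y - x)) - grad f x) \<le> M * (s * norm (y - x))"
  shows "f y \<le> f x + grad f x (y - x) + M / 2 * (norm (y - x))\<^sup>2"
proof -
  let ?d = "y - x"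
  define \<phi> where "\<phi> s = f (x + s *\<^sub>R ?d) - s * grad f x ?d - M * (norm ?d)\<^sup>2 * (s\<^sup>2 / 2)" for s
  have "\<phi> 1 \<le> \<phi> 0"
  proof (rule DERIV_nonpos_imp_nonincreasing[of 0 1 \<phi>])
    fix s :: real assume s: "0 \<le> s" "s \<le> 1"
    let ?w = "x + s *\<^sub>R ?d"
    have "((\<lambda>s. x + s *\<^sub>R ?d) has_derivative (\<lambda>s. s *\<^sub>R ?d)) (at s)"
      by (auto intro!: derivative_eq_intros)
    from has_derivative_compose[OF this has_derivative_grad[OF diff[OF s]]]
    have "((\<lambda>s. f (x + s *\<^sub>R ?d)) has_field_derivative grad f ?w ?d) (at s)"
      by (simp add: has_field_derivative_def blinfun.scaleR_right mult.commute[of _ "blinfun_apply _ _"])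
    then have "(\<phi> has_field_derivative (grad f ?w ?d - grad f x ?d - M * (norm ?d)\<^sup>2 * s)) (at s)"
      unfolding \<phi>_def by (auto intro!: derivative_eq_intros)
    moreover have "grad f ?w ?d - grad f x ?d \<le> M * (norm ?d)\<^sup>2 * s"
    proof -
      have "grad f ?w ?d - grad f x ?d \<le> norm (grad f ?w - grad f x) * norm ?d"
        using norm_blinfun[of "grad f ?w - grad f x" ?d] by (simp add: blinfun.diff_left)
      also have "\<dots> \<le> M * (s * norm ?d) * norm ?d"
        by (intro mult_right_mono bound s) simp
      finally show ?thesis by (simp add: power2_eq_square mult_ac)
    qed
    ultimately show "\<exists>l. DERIV \<phi> s :> l \<and> l \<le> 0" by force
  qed simp
  then show ?thesis by (simp add: \<phi>_def)
qed

lemma convex_on_grad_le: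
  fixes f :: "'a::real_normed_vector \<Rightarrow> real"
  assumes f: "convex_on X f" and X: "x \<in> X" "y \<in> X" and diff: "f differentiable at x"
  shows "f x + grad f x (y - x) \<le> f y"
proof -
  let ?d = "y - x"
  have "((\<lambda>s. x + s *\<^sub>R ?d) has_derivative (\<lambda>s. s *\<^sub>R ?d)) (at 0)"
    by (auto intro!: derivative_eq_intros)
  from has_derivative_compose[OF this, of f "grad f x"] has_derivative_grad[OF diff]
  have "((\<lambda>s. f (x + s *\<^sub>R ?d)) has_field_derivative grad f x ?d) (at 0)"
    by (simp add: has_field_derivative_def blinfun.scaleR_right mult.commute[of _ "blinfun_apply _ _"])
  then have "((\<lambda>s. (f (x + s *\<^sub>R ?d) - f x) / s) \<longlongrightarrow> grad f x ?d) (at 0)"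
    by (simp add: has_field_derivative_iff)
  then have lim: "((\<lambda>s. (f (x + s *\<^sub>R ?d) - f x) / s) \<longlongrightarrow> grad f x ?d) (at_right 0)"
    by (rule filterlim_mono) (auto simp: at_le)
  have "grad f x ?d \<le> f y - f x"
  proof (rule tendsto_upperbound[OF lim])
    show "\<forall>\<^sub>F s in at_right 0. (f (x + s *\<^sub>R ?d) - f x) / s \<le> f y - f x"
      using eventually_at_right_real[OF zero_less_one]
    proof eventually_elim
      case (elim s)
      have "x + s *\<^sub>R ?d = (1 - s) *\<^sub>R x + s *\<^sub>R y"
        by (simp add: algebra_simps)
      then have "f (x + s *\<^sub>R ?d) \<le> (1 - s) * f x + s * f y"
        using convex_onD[OF f, of s x y] X elim by simp
      then have "f (x + s *\<^sub>R ?d) - f x \<le> (f y - f x) * s"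
        by (simp add: algebra_simps)
      then show ?case using elim by (simp only: pos_divide_le_eq greaterThanLessThan_iff)
    qed
  qed simp
  then show ?thesis by simp
qed

locale ell_smooth_convex =
  fixes B X :: "'a::real_normed_vector set" and f :: "'a \<Rightarrow> real" and ell :: "real \<Rightarrow> real"
  assumes finite_B: "finite B" and span_B: "span B = UNIV"
    and open_X: "open X" and convex_X: "convex X"
    and f_convex: "convex_on X f"
    and f_closed: "\<And>a. closed {z \<in> X. f z \<le> a}"
    and ell_cont: "continuous_on {0..} ell"
    and ell_mono: "mono_on {0..} ell"
    and ell_pos: "\<And>a. 0 \<le> a \<Longrightarrow> 0 < ell a"
    and f_smooth: "ell_smooth B X ell f"
begin

lemma f_differentiable: "x \<in> X \<Longrightarrow> f differentiable at x"
  using f_smooth by (simp add: ell_smooth_def)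

lemma segment_in_X:
  assumes "x \<in> X" "y \<in> X" "0 \<le> s" "s \<le> 1"
  shows "x + s *\<^sub>R (y - x) \<in> X"
proof -
  have "x + s *\<^sub>R (y - x) = (1 - s) *\<^sub>R x + s *\<^sub>R y" by (simp add: algebra_simps)
  then show ?thesis using convexD[OF convex_X, of x y "1 - s" s] assms by simp
qed

lemma isCont_grad:
  assumes "x \<in> X" shows "isCont (grad f) x"
proof -
  obtain r C where "r > 0" and lip: "C-lipschitz_on (cball x r \<inter> X) (grad f)"
    using f_smooth assms unfolding ell_smooth_def by blast
  have "continuous_on (ball x r \<inter> X) (grad f)"
    using lipschitz_on_continuous_on[OF lip] by (rule continuous_on_subset) auto
  then show ?thesis
    using \<open>r > 0\<close> assms open_X by (auto simp: continuous_on_eq_continuous_at open_Int)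
qed

text \<open>By continuity \<open>ell (norm (grad f w))\<close> stays below \<open>K\<close> near
  \<open>x\<close>. The averaging argument is scalar, so it is applied to \<open>grad f w v\<close>
  as a function of \<open>w\<close> for each direction \<open>v\<close>; uniformity in
  \<open>v\<close> recovers the dual norm. The unspecified local constant \<open>C\<close> is
  thereby replaced by \<open>K\<close>.\<close>

lemma grad_lipschitz_near:
  assumes x: "x \<in> X" and K: "ell (norm (grad f x)) < K"
  obtains \<rho> where "0 < \<rho>" "ball x \<rho> \<subseteq> X" "K-lipschitz_on (ball x \<rho>) (grad f)"
proof -
  obtain r C where "r > 0" and lip: "C-lipschitz_on (cball x r \<inter> X) (grad f)"
    using f_smooth x unfolding ell_smooth_def by blast
  obtain r1 where "r1 > 0" and r1: "ball x r1 \<subseteq> X"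
    using open_X x openE by blast
  have K0: "0 \<le> K" using ell_pos[of "norm (grad f x)"] K by simp
  have "continuous (at (norm (grad f x)) within {0..}) ell"
    using ell_cont by (simp add: continuous_on_eq_continuous_within)
  then have "((\<lambda>w. ell (norm (grad f w))) \<longlongrightarrow> ell (norm (grad f x))) (at x)"
    using isCont_grad[OF x] unfolding continuous_within isCont_def
    by (intro continuous_within_tendsto_compose'[of "norm (grad f x)" "{0..}" ell] tendsto_norm)
      (auto simp: continuous_within)
  then have "\<forall>\<^sub>F w in at x. ell (norm (grad f w)) < K"
    using K by (rule order_tendstoD)
  then obtain r2 where "r2 > 0" and r2: "\<And>w. w \<noteq> x \<Longrightarrow> dist w x < r2 \<Longrightarrow> ell (norm (grad f w)) < K"
    by (auto simp: eventually_at)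
  define \<rho> where "\<rho> = min r (min r1 r2)"
  have \<rho>: "0 < \<rho>" using \<open>r > 0\<close> \<open>r1 > 0\<close> \<open>r2 > 0\<close> by (simp add: \<rho>_def)
  have sub: "ball x \<rho> \<subseteq> cball x r \<inter> X"
    using r1 by (auto simp: \<rho>_def)
  have lip\<rho>: "C-lipschitz_on (ball x \<rho>) (grad f)"
    using lip sub by (rule lipschitz_on_subset)
  have C: "0 \<le> C" using lip by (rule lipschitz_on_nonneg)
  have one: "grad f w2 v - grad f w1 v \<le> K * norm v * norm (w2 - w1)"
    if w: "w1 \<in> ball x \<rho>" "w2 \<in> ball x \<rho>" for w1 w2 v
  proof (rule lipschitz_diff_le_of_AE_deriv[OF finite_B span_B _ _ _ w, where C = "C * norm v"])
    show "(C * norm v)-lipschitz_on (ball x \<rho>) (\<lambda>w. grad f w v)"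
    proof (rule lipschitz_onI)
      fix p q assume "p \<in> ball x \<rho>" "q \<in> ball x \<rho>"
      then have "norm (grad f p - grad f q) \<le> C * norm (p - q)"
        using lipschitz_on_normD[OF lip\<rho>] by blast
      then have "norm (grad f p - grad f q) * norm v \<le> C * norm (p - q) * norm v"
        by (intro mult_right_mono) auto
      then show "dist (grad f p v) (grad f q v) \<le> C * norm v * dist p q"
        using norm_blinfun[of "grad f p - grad f q" v]
        by (simp add: dist_norm blinfun.diff_left mult_ac)
    qed (use C in simp)
    show "0 \<le> K * norm v" using K0 by simp
    have "AE_lebesgue B (\<lambda>x. x \<in> X \<longrightarrow> (\<exists>H. (grad f has_derivative H) (at x) \<and>
        (\<forall>h. norm (H h) \<le> ell (norm (grad f x)) * norm h)))"
      using f_smooth by (simp add: ell_smooth_def)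
    then show "AE_lebesgue B (\<lambda>w. w \<in> ball x \<rho> \<longrightarrow>
      (\<exists>H. ((\<lambda>w. grad f w v) has_derivative H) (at w) \<and> (\<forall>h. \<bar>H h\<bar> \<le> K * norm v * norm h)))"
    proof (rule AE_lebesgue_mono, intro impI)
      fix w assume *: "w \<in> X \<longrightarrow> (\<exists>H. (grad f has_derivative H) (at w) \<and>
          (\<forall>h. norm (H h) \<le> ell (norm (grad f w)) * norm h))" and w: "w \<in> ball x \<rho>"
      then obtain H where H: "(grad f has_derivative H) (at w)"
        and HK: "\<And>h. norm (H h) \<le> ell (norm (grad f w)) * norm h"
        using sub by blast
      have ellK: "ell (norm (grad f w)) \<le> K"
        using w K r2[of w] by (cases "w = x") (auto simp: \<rho>_def dist_commute)
      show "\<exists>H. ((\<lambda>w. grad f w v) has_derivative H) (at w) \<and> (\<forall>h. \<bar>H h\<bar> \<le> K * norm v * norm h)"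
      proof (intro exI[of _ "\<lambda>h. H h v"] conjI allI)
        show "((\<lambda>w. grad f w v) has_derivative (\<lambda>h. H h v)) (at w)"
          by (rule bounded_linear.has_derivative[OF blinfun.bounded_linear_left H])
        fix h
        have "\<bar>H h v\<bar> \<le> norm (H h) * norm v"
          using norm_blinfun[of "H h" v] by simp
        also have "\<dots> \<le> (K * norm h) * norm v"
          using HK[of h] ellK by (intro mult_right_mono order_trans[OF HK]) auto
        finally show "\<bar>H h v\<bar> \<le> K * norm v * norm h" by (simp add: mult_ac)
      qed
    qed
  qed
  have "K-lipschitz_on (ball x \<rho>) (grad f)"
  proof (rule lipschitz_onI[OF _ K0])
    fix p q assume pq: "p \<in> ball x \<rho>" "q \<in> ball x \<rho>"
    show "dist (grad f p) (grad f q) \<le> K * dist p q"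
      unfolding dist_norm
    proof (rule norm_blinfun_bound)
      fix v
      show "norm ((grad f p - grad f q) v) \<le> K * norm (p - q) * norm v"
        using one[OF pq, of v] one[OF pq(2,1), of v]
        by (simp add: blinfun.diff_left norm_minus_commute abs_le_iff mult_ac)
    qed (use K0 in simp)
  qed
  then show ?thesis using that \<rho> sub by blast
qed

text \<open>Around each point of the segment the gradient is Lipschitz with any constant above
  \<open>ell M\<close>; \<open>local_slope_bound\<close> chains these bounds although their radii
  vary.\<close>

lemma grad_diff_le_on_segment:
  assumes xy: "x \<in> X" "y \<in> X" and M: "0 \<le> M"
    and bound: "\<And>s. 0 \<le> s \<Longrightarrow> s \<le> 1 \<Longrightarrow> norm (grad f (x + s *\<^sub>R (y - x))) \<le> M"
  shows "norm (grad f y - grad f x) \<le> ell M * norm (y - x)"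
proof (rule field_le_epsilon)
  fix e :: real assume e: "0 < e"
  \<comment> \<open>\<open>grad_lipschitz_near\<close> needs a strict excess over
    \<open>ell M\<close>; this one costs at most \<open>e\<close> over the length
    \<open>norm (y - x)\<close>, and the \<open>+ 1\<close> covers \<open>y = x\<close>.\<close>
  define K where "K = ell M + e / (norm (y - x) + 1)"
  have K: "ell M < K"
    using e by (auto simp: K_def intro!: divide_pos_pos add_nonneg_pos)
  let ?p = "\<lambda>s. x + s *\<^sub>R (y - x)"
  have "norm (grad f (?p 1) - grad f (?p 0)) \<le> (K * norm (y - x)) * (1 - 0)"
  proof (rule local_slope_bound)
    fix s :: real assume s: "0 \<le> s" "s \<le> 1"
    have "ell (norm (grad f (?p s))) \<le> ell M"
      using bound[OF s] M by (intro mono_onD[OF ell_mono]) auto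
    then have "ell (norm (grad f (?p s))) < K" using K by simp
    then obtain \<rho> where \<rho>: "0 < \<rho>" "K-lipschitz_on (ball (?p s) \<rho>) (grad f)"
      using grad_lipschitz_near[OF segment_in_X[OF xy s]] by blast
    define \<delta> where "\<delta> = \<rho> / (norm (y - x) + 1)"
    have N: "0 < norm (y - x) + 1" by (intro add_nonneg_pos) auto
    show "\<exists>d>0. \<forall>t\<ge>0. t \<le> 1 \<longrightarrow> \<bar>t - s\<bar> < d \<longrightarrow>
        norm (grad f (?p t) - grad f (?p s)) \<le> K * norm (y - x) * \<bar>t - s\<bar>"
    proof (intro exI[of _ \<delta>] conjI allI impI)
      show "0 < \<delta>" using \<rho> N by (simp add: \<delta>_def)
      fix t assume "\<bar>t - s\<bar> < \<delta>"
      have diff: "norm (?p t - ?p s) = \<bar>t - s\<bar> * norm (y - x)"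
        by (simp flip: scaleR_diff_left)
      also have "\<dots> \<le> \<bar>t - s\<bar> * (norm (y - x) + 1)"
        by (intro mult_left_mono) auto
      also have "\<dots> < \<delta> * (norm (y - x) + 1)"
        using \<open>\<bar>t - s\<bar> < \<delta>\<close> N by (rule mult_strict_right_mono)
      also have "\<dots> = \<rho>" using N by (simp add: \<delta>_def)
      finally have "?p t \<in> ball (?p s) \<rho>" by (simp only: mem_ball dist_norm norm_minus_commute)
      moreover have "?p s \<in> ball (?p s) \<rho>" using \<rho>(1) by simp
      ultimately have "norm (grad f (?p t) - grad f (?p s)) \<le> K * norm (?p t - ?p s)"
        by (rule lipschitz_on_normD[OF \<rho>(2)])
      then show "norm (grad f (?p t) - grad f (?p s)) \<le> K * norm (y - x) * \<bar>t - s\<bar>"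
        by (simp only: diff mult_ac)
    qed
  qed simp
  also have "\<dots> = ell M * norm (y - x) + e * (norm (y - x) / (norm (y - x) + 1))"
    by (simp add: K_def algebra_simps)
  also have "norm (y - x) / (norm (y - x) + 1) \<le> 1"
    by (simp add: divide_le_eq_1 add_nonneg_pos)
  finally show "norm (grad f y - grad f x) \<le> ell M * norm (y - x) + e"
    using e by simp
qed

text \<open>
  A gradient bound of \<open>2 * a\<close> cannot be exceeded before the Lipschitz constant \<open>ell (2 * a)\<close>,
  valid as long as it holds, has let the gradient grow by \<open>a\<close>.
\<close>

lemma grad_near:
  assumes xy: "x \<in> X" "y \<in> X" and a: "norm (grad f x) \<le> a"
    and near: "y = x \<or> norm (y - x) * ell (2 * a) < a"
    and s: "0 \<le> s" "s \<le> 1"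
  shows "norm (grad f (x + s *\<^sub>R (y - x)) - grad f x) \<le> ell (2 * a) * (s * norm (y - x))"
proof (cases "y = x")
  case False
  let ?p = "\<lambda>s. x + s *\<^sub>R (y - x)"
  have a0: "0 \<le> a" using a norm_ge_zero order_trans by blast
  with near False have lt: "norm (y - x) * ell (2 * a) < a" by blast
  have "0 \<le> norm (y - x) * ell (2 * a)"
    using ell_pos[of "2 * a"] a0 by (intro mult_nonneg_nonneg) auto
  with lt have apos: "0 < a" by linarith
  have step: "norm (grad f (?p t) - grad f x) \<le> ell (2 * a) * (t * norm (y - x))"
    if t: "0 \<le> t" "t \<le> 1" and le: "\<And>u. 0 \<le> u \<Longrightarrow> u \<le> t \<Longrightarrow> norm (grad f (?p u)) \<le> 2 * a" for t
  proof -
    have "norm (grad f (?p t) - grad f x) \<le> ell (2 * a) * norm (?p t - x)"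
    proof (rule grad_diff_le_on_segment[OF xy(1) segment_in_X[OF xy t]])
      fix u :: real assume "0 \<le> u" "u \<le> 1"
      then have "0 \<le> u * t" "u * t \<le> t" using t by (auto simp: mult_left_le_one_le)
      then show "norm (grad f (x + u *\<^sub>R (?p t - x))) \<le> 2 * a"
        using le[of "u * t"] by simp
    qed (use a0 in simp)
    then show ?thesis using t by simp
  qed
  have cont: "continuous_on {0..1} (\<lambda>s. grad f (?p s))"
  proof (rule continuous_at_imp_continuous_on, rule ballI)
    fix s :: real assume "s \<in> {0..1}"
    then have "isCont (grad f) (?p s)" using isCont_grad segment_in_X[OF xy] by auto
    then show "isCont (\<lambda>s. grad f (?p s)) s"
      by (intro isCont_o2[where f = ?p and g = "grad f"]) (auto intro!: continuous_intros)
  qed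
  \<comment> \<open>If the norm ever reaches \<open>2 * a\<close>, there is a first such time
    \<open>t0\<close>. Continuity from the left gives the bound \<open>2 * a\<close> up to and
    including \<open>t0\<close>, so \<open>step\<close> applies there and makes it strict.\<close>
  let ?S = "{0..1} \<inter> (\<lambda>t. norm (grad f (?p t))) -` {2 * a..}"
  have "?S = {}"
  proof (rule ccontr)
    assume ne: "?S \<noteq> {}"
    have "closed ?S"
      by (intro continuous_closed_preimage continuous_on_norm cont) auto
    then obtain t0 where t0: "t0 \<in> ?S" and min: "\<And>t. t \<in> ?S \<Longrightarrow> t0 \<le> t"
      using closed_attains_least[OF _ Int_lower1 ne] by blast
    have below: "norm (grad f (?p u)) < 2 * a" if "0 \<le> u" "u < t0" for u
      using min[of u] that t0 by force
    have "0 < t0"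
    proof (rule ccontr)
      assume "\<not> 0 < t0"
      then have "t0 = 0" using t0 by simp
      then show False using t0 a apos by simp
    qed
    have "norm (grad f (?p t0)) \<le> 2 * a"
    proof (rule tendsto_upperbound[of "\<lambda>u. norm (grad f (?p u))"])
      have "isCont (\<lambda>s. grad f (?p s)) t0"
        using t0 isCont_grad segment_in_X[OF xy]
        by (intro isCont_o2[where f = ?p and g = "grad f"]) (auto intro!: continuous_intros)
      then show "((\<lambda>u. norm (grad f (?p u))) \<longlongrightarrow> norm (grad f (?p t0))) (at_left t0)"
        by (intro tendsto_norm) (simp add: isCont_def filterlim_at_split)
      show "\<forall>\<^sub>F u in at_left t0. norm (grad f (?p u)) \<le> 2 * a"
        using eventually_at_left_real[OF \<open>0 < t0\<close>]
        by eventually_elim (use below in \<open>auto intro: less_imp_le\<close>)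
    qed simp
    then have "norm (grad f (?p u)) \<le> 2 * a" if "0 \<le> u" "u \<le> t0" for u
      using below[of u] that by (cases "u = t0") auto
    then have "norm (grad f (?p t0) - grad f x) \<le> ell (2 * a) * (t0 * norm (y - x))"
      using t0 by (intro step) auto
    also have "\<dots> \<le> norm (y - x) * ell (2 * a)"
      using t0 ell_pos[of "2 * a"] a0 by (simp add: mult_left_le_one_le mult_ac)
    also have "\<dots> < a" by (rule lt)
    finally have "norm (grad f (?p t0)) < 2 * a"
      using norm_triangle_ineq2[of "grad f (?p t0)" "grad f x"] a by linarith
    then show False using t0 by simp
  qed
  then have "norm (grad f (?p u)) \<le> 2 * a" if "0 \<le> u" "u \<le> 1" for u
    using that by (auto simp: not_le intro: less_imp_le)
  then show ?thesis using s by (intro step) auto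
qed simp

lemma descent_near:
  assumes xy: "x \<in> X" "y \<in> X" and a: "norm (grad f x) \<le> a"
    and near: "y = x \<or> norm (y - x) * ell (2 * a) < a"
  shows "f y \<le> f x + grad f x (y - x) + ell (2 * a) / 2 * (norm (y - x))\<^sup>2"
  by (intro descent_of_grad_bound f_differentiable segment_in_X xy grad_near[OF xy a near])

lemma grad_diff_near:
  assumes xy: "x \<in> X" "y \<in> X" and a: "norm (grad f x) \<le> a"
    and near: "y = x \<or> norm (y - x) * ell (2 * a) < a"
  shows "norm (grad f y - grad f x) \<le> ell (2 * a) * norm (y - x)"
  using grad_near[OF assms, of 1] by simp

text \<open>
  Walk from \<open>x\<close> in a direction of steepest descent for the time \<open>b / ell (2 * a)\<close>. Closedness of
  the sublevel sets keeps the path, along which \<open>f\<close> stays below \<open>f x\<close>, inside the domain.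
\<close>

lemma norm_grad_sq_le_gap:
  assumes x: "x \<in> X" and lower: "\<And>z. z \<in> X \<Longrightarrow> m \<le> f z"
  shows "(norm (grad f x))\<^sup>2 \<le> 2 * ell (2 * norm (grad f x)) * (f x - m)"
proof (cases "grad f x = 0")
  case True
  then show ?thesis using lower[OF x] ell_pos[of 0] by simp
next
  case False
  define a where "a = norm (grad f x)"
  define K where "K = ell (2 * a)"
  have a: "0 < a" using False by (simp add: a_def)
  have K: "0 < K" using ell_pos[of "2 * a"] a by (simp add: K_def)
  \<comment> \<open>Working with \<open>b < a\<close> spares a direction that attains the dual norm,
    and makes the walk of length \<open>b / K\<close> strictly shorter than the radius
    \<open>a / K\<close>.\<close>
  have "b \<le> sqrt (2 * K * (f x - m))" if b: "0 < b" "b < a" for b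
  proof -
    have "\<exists>v. b * norm v < \<bar>grad f x v\<bar>"
    proof (rule ccontr)
      assume "\<not> ?thesis"
      then have "norm (grad f x) \<le> b"
        using b by (intro norm_blinfun_bound) (auto simp: not_less)
      then show False using b by (simp add: a_def)
    qed
    then obtain v where v: "b * norm v < \<bar>grad f x v\<bar>" by blast
    then have "v \<noteq> 0" by (auto simp: blinfun.zero_right)
    define h where "h = - (sgn (grad f x v) / norm v) *\<^sub>R v"
    have "grad f x v \<noteq> 0" using v b by (auto simp: mult_less_0_iff)
    then have h: "norm h = 1"
      using \<open>v \<noteq> 0\<close> by (simp add: h_def abs_sgn_eq)
    have "grad f x h = - (\<bar>grad f x v\<bar> / norm v)"
      by (simp add: h_def blinfun.scaleR_right blinfun.minus_right sgn_if)
    moreover have "b < \<bar>grad f x v\<bar> / norm v"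
      using v \<open>v \<noteq> 0\<close> by (simp add: pos_less_divide_eq)
    ultimately have gh: "grad f x h \<le> - b" by simp
    let ?p = "\<lambda>s. x + s *\<^sub>R h"
    have dec: "f (?p s) \<le> f x - s * b + K / 2 * s\<^sup>2" if "0 \<le> s" "s \<le> b / K" "?p s \<in> X" for s
    proof -
      have "s * K < a" using that K b by (simp add: pos_le_divide_eq)
      then have "f (?p s) \<le> f x + grad f x (?p s - x) + ell (2 * a) / 2 * (norm (?p s - x))\<^sup>2"
        using that h by (intro descent_near x) (auto simp: a_def K_def)
      also have "grad f x (?p s - x) \<le> - (s * b)"
        using mult_left_mono[OF gh \<open>0 \<le> s\<close>] by (simp add: blinfun.scaleR_right)
      finally show ?thesis using that h by (simp add: K_def)
    qed
    have below: "f (?p s) \<le> f x" if "0 \<le> s" "s \<le> b / K" "?p s \<in> X" for s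
    proof -
      have "s * K \<le> b" using that K by (simp add: pos_le_divide_eq)
      then have "s * (s * K) \<le> s * b" using that by (intro mult_left_mono) auto
      moreover have "0 \<le> s * b" using that b by simp
      ultimately show ?thesis using dec[OF that] by (simp add: power2_eq_square algebra_simps)
    qed
    let ?S = "{0..b / K} \<inter> ?p -` (- X)"
    have "?S = {}"
    proof (rule ccontr)
      assume ne: "?S \<noteq> {}"
      have "closed ?S"
        using open_X by (intro continuous_closed_preimage continuous_intros) auto
      then obtain s0 where s0: "s0 \<in> ?S" and min: "\<And>s. s \<in> ?S \<Longrightarrow> s0 \<le> s"
        using closed_attains_least[OF _ Int_lower1 ne] by blast
      have "s0 \<noteq> 0" using s0 x by auto
      then have "0 < s0" using s0 by simp
      have "?p s0 \<in> {z \<in> X. f z \<le> f x}"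
      proof (rule Lim_in_closed_set[OF f_closed])
        show "\<forall>\<^sub>F s in at_left s0. ?p s \<in> {z \<in> X. f z \<le> f x}"
          using eventually_at_left_real[OF \<open>0 < s0\<close>]
        proof eventually_elim
          case (elim s)
          then have s: "0 \<le> s" "s \<le> b / K" using s0 by auto
          moreover have "?p s \<in> X" using min[of s] elim s by fastforce
          ultimately show ?case using below by simp
        qed
        show "(?p \<longlongrightarrow> ?p s0) (at_left s0)" by (intro tendsto_intros)
      qed simp
      then show False using s0 by simp
    qed
    moreover have \<sigma>: "0 \<le> b / K" using b K by simp
    ultimately have pX: "?p (b / K) \<in> X" by auto
    \<comment> \<open>\<open>b / K\<close> minimizes the quadratic
      \<open>- s * b + K / 2 * s\<^sup>2\<close>, with least value
      \<open>- b\<^sup>2 / (2 * K)\<close>.\<close>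
    have "m \<le> f (?p (b / K))" using lower[OF pX] .
    also have "\<dots> \<le> f x - b / K * b + K / 2 * (b / K)\<^sup>2"
      using dec[OF \<sigma> _ pX] by simp
    also have "\<dots> = f x - b\<^sup>2 / (2 * K)"
      using K by (simp add: field_simps power2_eq_square)
    finally have "b\<^sup>2 / (2 * K) \<le> f x - m" by simp
    then have "b\<^sup>2 \<le> 2 * K * (f x - m)"
      using K by (simp add: pos_divide_le_eq mult_ac)
    then show ?thesis by (rule real_le_rsqrt)
  qed
  \<comment> \<open>The bound is free of \<open>b\<close>, so it survives letting \<open>b\<close>
    approach \<open>a\<close>.\<close>
  then have "a \<le> sqrt (2 * K * (f x - m))"
    by (rule dense_le_bounded[OF a])
  then have "a\<^sup>2 \<le> (sqrt (2 * K * (f x - m)))\<^sup>2"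
    using a by (intro power_mono) auto
  also have "\<dots> = 2 * K * (f x - m)"
    using lower[OF x] K by simp
  finally show ?thesis by (simp add: a_def K_def)
qed

end

section \<open>Mirror prox steps\<close>

text \<open>As \<open>X\<close> is open, \<open>x\<close> is an interior minimum of
  \<open>\<psi>\<close> minus the functional \<open>u\<close>, so the derivative of the difference
  vanishes.\<close>

lemma subgradient_eq_grad:
  assumes "open X" "x \<in> X" and diff: "\<psi> differentiable at x" and u: "u \<in> subdifferential X \<psi> x"
  shows "u = grad \<psi> x"
proof -
  have "((\<lambda>z. \<psi> z - blinfun_apply u z) has_derivative (\<lambda>h. grad \<psi> x h - u h)) (at x)"
    by (intro has_derivative_diff has_derivative_grad diff bounded_linear_imp_has_derivative blinfun.bounded_linear_right)
  moreover have "\<forall>\<^sub>F z in at x. \<psi> x - u x \<le> \<psi> z - u z"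
  proof -
    have "\<forall>\<^sub>F z in at x. z \<in> X"
      using assms(1,2) by (rule eventually_at_in_open')
    then show ?thesis
      by eventually_elim (use u in \<open>auto simp: subdifferential_def blinfun.diff_right algebra_simps\<close>)
  qed
  ultimately have "(\<lambda>h. grad \<psi> x h - u h) = (\<lambda>h. 0)"
    by (rule has_derivative_local_min)
  then show ?thesis by (intro blinfun_eqI) (metis eq_iff_diff_eq_0)
qed

lemma bregman_three_point:
  "(grad \<psi> q - grad \<psi> p) (p - u) = bregman \<psi> u q - bregman \<psi> u p - bregman \<psi> p q"
  by (simp add: bregman_def blinfun.diff_left blinfun.diff_right)

locale open_mirror_map =
  fixes X :: "'a::real_normed_vector set" and \<psi> :: "'a \<Rightarrow> real"
  assumes open_dom: "open X" and psi: "mirror_map X \<psi>"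
begin

abbreviation "D \<equiv> subdiff_domain X \<psi>"

lemma D_in_X: "x \<in> D \<Longrightarrow> x \<in> X"
  by (simp add: subdiff_domain_def)

lemma psi_diff: "x \<in> D \<Longrightarrow> \<psi> differentiable at x"
  using psi by (simp add: mirror_map_def)

lemma psi_strongly_monotone:
  "x \<in> D \<Longrightarrow> z \<in> D \<Longrightarrow> (norm (x - z))\<^sup>2 \<le> (grad \<psi> x - grad \<psi> z) (x - z)"
  using psi by (simp add: mirror_map_def)

lemma D_I:
  assumes "x \<in> X" "u \<in> subdifferential X \<psi> x"
  shows "x \<in> D" "grad \<psi> x = u"
proof -
  show "x \<in> D" using assms by (auto simp: subdiff_domain_def)
  then show "grad \<psi> x = u"
    using subgradient_eq_grad[OF open_dom assms(1) psi_diff assms(2)] by simp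
qed

lemma argmin_in_D:
  assumes "is_arg_min \<psi> (\<lambda>z. z \<in> X) x"
  shows "x \<in> D"
  using assms by (intro D_I(1)[where u = 0]) (auto simp: is_arg_min_linorder subdifferential_def)

text \<open>Minimality of \<open>z\<close> rearranges to the subgradient inequality for
  \<open>grad \<psi> w - g\<close>. On an open domain the optimality condition is therefore an
  equation and not merely a variational inequality.\<close>

lemma prox_in_D:
  assumes "z \<in> prox X \<psi> w g"
  shows "z \<in> D" "grad \<psi> z = grad \<psi> w - g"
proof -
  have z: "z \<in> X"
    and "\<And>x. x \<in> X \<Longrightarrow> g z + bregman \<psi> z w \<le> g x + bregman \<psi> x w"
    using assms by (auto simp: prox_def is_arg_min_linorder)
  then have "grad \<psi> w - g \<in> subdifferential X \<psi> z"
    by (force simp: subdifferential_def bregman_def blinfun.diff_left blinfun.diff_right)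
  with z show "z \<in> D" "grad \<psi> z = grad \<psi> w - g" by (auto intro: D_I)
qed

lemma bregman_nonneg:
  assumes "z \<in> D" "x \<in> X"
  shows "0 \<le> bregman \<psi> x z"
proof -
  obtain u where u: "u \<in> subdifferential X \<psi> z"
    using assms by (auto simp: subdiff_domain_def)
  then have "grad \<psi> z = u" using D_I D_in_X assms by blast
  with u assms show ?thesis by (auto simp: subdifferential_def bregman_def)
qed

text \<open>Strong monotonicity with one factor of the norm cancelled: the inverse of
  \<open>grad \<psi>\<close> is nonexpansive. With \<open>prox_in_D\<close> it turns dual
  displacements into bounds on step lengths.\<close>

lemma norm_diff_le_grad_diff:
  assumes "p \<in> D" "q \<in> D"
  shows "norm (p - q) \<le> norm (grad \<psi> p - grad \<psi> q)"
proof (cases "p = q")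
  case False
  have "(norm (p - q))\<^sup>2 \<le> norm (grad \<psi> p - grad \<psi> q) * norm (p - q)"
    using psi_strongly_monotone[OF assms] norm_blinfun[of "grad \<psi> p - grad \<psi> q" "p - q"] by simp
  then show ?thesis using False by (simp add: power2_eq_square)
qed simp

text \<open>Convexity of \<open>D\<close> keeps the segment where strong monotonicity holds; along
  it, \<open>\<psi>\<close> minus its linear and quadratic lower terms is nondecreasing.\<close>

lemma bregman_ge:
  assumes "p \<in> D" "q \<in> D"
  shows "(norm (p - q))\<^sup>2 / 2 \<le> bregman \<psi> p q"
proof -
  let ?d = "p - q"
  define \<phi> where "\<phi> s = \<psi> (q + s *\<^sub>R ?d) - s * grad \<psi> q ?d - (norm ?d)\<^sup>2 * (s\<^sup>2 / 2)" for s
  have "\<phi> 0 \<le> \<phi> 1"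
  proof (rule DERIV_nonneg_imp_nondecreasing[of 0 1 \<phi>])
    fix s :: real assume s: "0 \<le> s" "s \<le> 1"
    let ?w = "q + s *\<^sub>R ?d"
    have "?w = (1 - s) *\<^sub>R q + s *\<^sub>R p" by (simp add: algebra_simps)
    then have w: "?w \<in> D"
      using convexD[of D q p "1 - s" s] psi assms s by (simp add: mirror_map_def)
    have "((\<lambda>s. q + s *\<^sub>R ?d) has_derivative (\<lambda>s. s *\<^sub>R ?d)) (at s)"
      by (auto intro!: derivative_eq_intros)
    from has_derivative_compose[OF this has_derivative_grad[OF psi_diff[OF w]]]
    have "((\<lambda>s. \<psi> (q + s *\<^sub>R ?d)) has_field_derivative grad \<psi> ?w ?d) (at s)"
      by (simp add: has_field_derivative_def blinfun.scaleR_right mult.commute[of _ "blinfun_apply _ _"])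
    then have "(\<phi> has_field_derivative (grad \<psi> ?w ?d - grad \<psi> q ?d - (norm ?d)\<^sup>2 * s)) (at s)"
      unfolding \<phi>_def by (auto intro!: derivative_eq_intros)
    moreover have "(norm ?d)\<^sup>2 * s \<le> grad \<psi> ?w ?d - grad \<psi> q ?d"
    proof (cases "s = 0")
      case False
      have "s * (s * (norm ?d)\<^sup>2) \<le> s * (grad \<psi> ?w ?d - grad \<psi> q ?d)"
        using psi_strongly_monotone[OF w assms(2)] s
        by (simp add: power_mult_distrib power2_eq_square blinfun.diff_left blinfun.scaleR_right mult_ac)
      then show ?thesis using False s by (simp add: mult.commute)
    qed simp
    ultimately show "\<exists>l. DERIV \<phi> s :> l \<and> 0 \<le> l" by force
  qed simp
  then show ?thesis by (simp add: \<phi>_def bregman_def)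
qed

end

section \<open>One mirror prox step: descent and regret\<close>

locale mirror_prox = ell_smooth_convex B X f ell + open_mirror_map X \<psi>
  for B X :: "'a::real_normed_vector set" and f ell \<psi>
begin

text \<open>The gradient bound is available only on the sublevel set of \<open>f x\<close>. Descent
  of the first half-step must therefore come before the bound at \<open>y\<close>, from which
  \<open>x'\<close> is then controlled.\<close>

lemma mirror_prox_step:
  assumes x: "x \<in> D"
    and G: "\<And>z. z \<in> X \<Longrightarrow> f z \<le> f x \<Longrightarrow> norm (grad f z) \<le> G"
    and \<eta>: "0 < \<eta>" "\<eta> * (2 * ell (2 * G)) \<le> 1"
    and y: "y \<in> prox X \<psi> x (\<eta> *\<^sub>R grad f x)"
    and x': "x' \<in> prox X \<psi> x (\<eta> *\<^sub>R grad f y)"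
    and u: "u \<in> X"
  shows "y \<in> D" "x' \<in> D" "f y \<le> f x" "f x' \<le> f x"
    and "\<eta> * (f y - f u) \<le> bregman \<psi> u x - bregman \<psi> u x'"
proof -
  show yD: "y \<in> D" and x'D: "x' \<in> D" using prox_in_D y x' by auto
  have X: "x \<in> X" "y \<in> X" "x' \<in> X" using x yD x'D D_in_X by auto
  have gy: "grad \<psi> y = grad \<psi> x - \<eta> *\<^sub>R grad f x" and gx': "grad \<psi> x' = grad \<psi> x - \<eta> *\<^sub>R grad f y"
    using prox_in_D y x' by auto
  define L where "L = ell (2 * G)"
  have Gx: "norm (grad f x) \<le> G" using G X by simp
  have G0: "0 \<le> G" using Gx norm_ge_zero order_trans by blast
  have L: "0 < L" using ell_pos G0 by (simp add: L_def)
  have \<eta>L: "\<eta> * L \<le> 1 / 2" using \<eta> by (simp add: L_def)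
  \<comment> \<open>\<open>\<eta> * G * L \<le> G / 2\<close> is strictly below \<open>G\<close>
    unless \<open>G = 0\<close>; then the displacement vanishes, which is why the local estimates
    carry an equality alternative.\<close>
  have near: "q = p \<or> norm (q - p) * ell (2 * G) < G" if "norm (q - p) \<le> \<eta> * G" for p q :: 'a
  proof (cases "G = 0")
    case False
    have "norm (q - p) * L \<le> \<eta> * G * L" using that L by (intro mult_right_mono) auto
    also have "\<dots> \<le> 1 / 2 * G" using mult_right_mono[OF \<eta>L G0] by (simp add: mult_ac)
    also have "\<dots> < G" using False G0 by simp
    finally show ?thesis by (simp add: L_def)
  qed (use that in simp)
  define N where "N = norm (y - x)"
  define R where "R = norm (x' - y)"
  define S where "S = norm (x' - x)"
  have nonneg: "0 \<le> N" "0 \<le> R" "0 \<le> S" by (auto simp: N_def R_def S_def)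
  have "N \<le> norm (\<eta> *\<^sub>R grad f x)"
    using norm_diff_le_grad_diff[OF yD x] by (simp add: N_def gy)
  then have N: "N \<le> \<eta> * G"
    using \<eta>(1) Gx by (simp add: order_trans[OF _ mult_left_mono])
  note near_y = near[OF N[unfolded N_def]]
  have gyx: "norm (grad f y - grad f x) \<le> L * N"
    using grad_diff_near[OF X(1,2) Gx near_y] by (simp add: L_def N_def)
  have "R \<le> norm (\<eta> *\<^sub>R (grad f x - grad f y))"
    using norm_diff_le_grad_diff[OF x'D yD] by (simp add: R_def gy gx' algebra_simps)
  also have "\<dots> \<le> \<eta> * (L * N)"
    using \<eta>(1) gyx by (simp add: norm_minus_commute)
  also have "\<dots> \<le> 1 / 2 * N"
    using mult_right_mono[OF \<eta>L nonneg(1)] by (simp add: mult_ac)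
  \<comment> \<open>Both prox points start from \<open>x\<close>, so their dual images differ by
    \<open>\<eta>\<close> times a gradient difference. Smoothness makes \<open>x' - y\<close> at
    most half as long as \<open>y - x\<close>, hence no longer than \<open>x' - x\<close>.\<close>
  finally have R: "R \<le> N / 2" by simp
  have "N \<le> S + R"
    using norm_triangle_ineq4[of "x' - x" "x' - y"] by (simp add: N_def S_def R_def)
  with R have RS: "R \<le> S" by simp
  have quad: "\<eta> * (L / 2 * c\<^sup>2) \<le> c\<^sup>2 / 4" for c
    using mult_right_mono[OF \<eta>L zero_le_power2[of c]] by (simp add: mult_ac)
  show fy: "f y \<le> f x"
  proof -
    have "f y \<le> f x + grad f x (y - x) + L / 2 * N\<^sup>2"
      using descent_near[OF X(1,2) Gx near_y] by (simp add: L_def N_def)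
    then have "\<eta> * f y \<le> \<eta> * (f x + grad f x (y - x) + L / 2 * N\<^sup>2)"
      using \<eta>(1) by simp
    also have "\<dots> = \<eta> * f x + \<eta> * grad f x (y - x) + \<eta> * (L / 2 * N\<^sup>2)"
      by (simp add: distrib_left)
    finally have "\<eta> * f y \<le> \<dots>" .
    moreover have "N\<^sup>2 \<le> - (\<eta> * grad f x (y - x))"
      using psi_strongly_monotone[OF yD x]
      by (simp add: gy N_def blinfun.minus_left blinfun.scaleR_left)
    ultimately have "\<eta> * f y \<le> \<eta> * f x"
      using quad[of N] zero_le_power2[of N] by linarith
    then show ?thesis using \<eta>(1) by simp
  qed
  have Gy: "norm (grad f y) \<le> G" using G X fy by simp
  have "R \<le> \<eta> * G" using R N nonneg by simp
  note near_x' = near[OF this[unfolded R_def]]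
  \<comment> \<open>Descent from \<open>y\<close> to \<open>x'\<close> and convexity at
    \<open>y\<close> towards \<open>x\<close>: their linear terms add up to
    \<open>grad f y (x' - x)\<close>, which the second prox step bounds by
    \<open>- S\<^sup>2 / \<eta>\<close>. Since \<open>R \<le> S\<close>, this absorbs the curvature
    error.\<close>
  show "f x' \<le> f x"
  proof -
    have "f x' \<le> f y + grad f y (x' - y) + L / 2 * R\<^sup>2"
      using descent_near[OF X(2,3) Gy near_x'] by (simp add: L_def R_def)
    moreover have "f y + grad f y (x - y) \<le> f x"
      by (intro convex_on_grad_le[OF f_convex] X f_differentiable)
    moreover have "grad f y (x' - y) = grad f y (x' - x) + grad f y (x - y)"
      by (simp flip: blinfun.add_right)
    ultimately have "f x' \<le> f x + grad f y (x' - x) + L / 2 * R\<^sup>2" by linarith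
    then have "\<eta> * f x' \<le> \<eta> * (f x + grad f y (x' - x) + L / 2 * R\<^sup>2)"
      using \<eta>(1) by simp
    also have "\<dots> = \<eta> * f x + \<eta> * grad f y (x' - x) + \<eta> * (L / 2 * R\<^sup>2)"
      by (simp add: distrib_left)
    finally have "\<eta> * f x' \<le> \<dots>" .
    moreover have "S\<^sup>2 \<le> - (\<eta> * grad f y (x' - x))"
      using psi_strongly_monotone[OF x'D x]
      by (simp add: gx' S_def blinfun.minus_left blinfun.scaleR_left)
    moreover have "R\<^sup>2 \<le> S\<^sup>2" using RS nonneg by (intro power_mono)
    ultimately have "\<eta> * f x' \<le> \<eta> * f x"
      using quad[of R] zero_le_power2[of R] by linarith
    then show ?thesis using \<eta>(1) by simp
  qed
  show "\<eta> * (f y - f u) \<le> bregman \<psi> u x - bregman \<psi> u x'"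
  proof -
    have "f y + grad f y (u - y) \<le> f u"
      by (intro convex_on_grad_le[OF f_convex] X u f_differentiable)
    then have "f y - f u \<le> grad f y (y - u)"
      by (simp add: blinfun.diff_right)
    then have "\<eta> * (f y - f u) \<le> \<eta> * grad f y (y - u)"
      using \<eta>(1) by simp
    \<comment> \<open>The actual step tested against \<open>u\<close>, the trial step against
      \<open>x'\<close>, and the error of using \<open>grad f x\<close> for \<open>grad f y\<close>.
      In the two three-point identities \<open>bregman \<psi> x' x\<close> cancels; the remaining
      negative terms absorb the error.\<close>
    also have "\<eta> * grad f y (y - u) =
        (grad \<psi> x - grad \<psi> x') (x' - u) + (grad \<psi> x - grad \<psi> y) (y - x')
          + \<eta> * (grad f y - grad f x) (y - x')"
      by (simp add: gy gx' blinfun.diff_right blinfun.diff_left blinfun.scaleR_left algebra_simps)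
    also have "\<dots> = bregman \<psi> u x - bregman \<psi> u x' - bregman \<psi> x' y - bregman \<psi> y x
          + \<eta> * (grad f y - grad f x) (y - x')"
      by (simp add: bregman_three_point)
    also have "\<eta> * (grad f y - grad f x) (y - x') \<le> N\<^sup>2 / 2 + R\<^sup>2 / 2"
    proof -
      have "(grad f y - grad f x) (y - x') \<le> norm (grad f y - grad f x) * R"
        using norm_blinfun[of "grad f y - grad f x" "y - x'"] by (simp add: R_def norm_minus_commute)
      also have "\<dots> \<le> L * N * R" using gyx nonneg by (intro mult_right_mono)
      finally have "\<eta> * (grad f y - grad f x) (y - x') \<le> (\<eta> * L) * (N * R)"
        using \<eta>(1) by (simp add: mult.assoc)
      also have "\<dots> \<le> 1 / 2 * (N * R)"
        using \<eta>L nonneg by (intro mult_right_mono) auto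
      also have "\<dots> \<le> N\<^sup>2 / 2 + R\<^sup>2 / 2"
        using sum_squares_bound[of N R] mult_nonneg_nonneg[OF nonneg(1,2)] by linarith
      finally show ?thesis .
    qed
    also have "N\<^sup>2 / 2 \<le> bregman \<psi> y x"
      using bregman_ge[OF yD x] by (simp add: N_def)
    also have "R\<^sup>2 / 2 \<le> bregman \<psi> x' y"
      using bregman_ge[OF x'D yD] by (simp add: R_def)
    finally show ?thesis by simp
  qed
qed

end

text \<open>Makes the \<open>Sup\<close> defining \<open>G\<close> a genuine upper bound of its
  set.\<close>

lemma bdd_above_subquadratic:
  fixes ell :: "real \<Rightarrow> real"
  assumes pos: "\<And>a. 0 \<le> a \<Longrightarrow> 0 < ell a"
    and lim: "filterlim (\<lambda>\<alpha>. \<alpha>\<^sup>2 / ell \<alpha>) at_top at_top"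
  shows "bdd_above {\<alpha>. 0 \<le> \<alpha> \<and> \<alpha>\<^sup>2 \<le> 2 * ell (2 * \<alpha>) * c}"
proof -
  \<comment> \<open>Membership says that the quotient at \<open>2 * \<alpha>\<close> is at most
    \<open>8 * c\<close>; the threshold \<open>8 * c + 1\<close> excludes this.\<close>
  have "\<forall>\<^sub>F \<alpha> in at_top. 8 * c + 1 \<le> \<alpha>\<^sup>2 / ell \<alpha>"
    using lim by (auto simp: filterlim_at_top)
  then obtain N where N: "\<And>\<alpha>. N \<le> \<alpha> \<Longrightarrow> 8 * c + 1 \<le> \<alpha>\<^sup>2 / ell \<alpha>"
    by (auto simp: eventually_at_top_linorder)
  show ?thesis
  proof (rule bdd_aboveI)
    fix \<alpha> assume "\<alpha> \<in> {\<alpha>. 0 \<le> \<alpha> \<and> \<alpha>\<^sup>2 \<le> 2 * ell (2 * \<alpha>) * c}"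
    then have \<alpha>: "0 \<le> \<alpha>" "\<alpha>\<^sup>2 \<le> 2 * ell (2 * \<alpha>) * c" by auto
    have e: "0 < ell (2 * \<alpha>)" using pos \<alpha> by simp
    show "\<alpha> \<le> N"
    proof (rule ccontr)
      assume "\<not> \<alpha> \<le> N"
      then have "8 * c + 1 \<le> (2 * \<alpha>)\<^sup>2 / ell (2 * \<alpha>)" using \<alpha> by (intro N) simp
      then have "(8 * c + 1) * ell (2 * \<alpha>) \<le> 4 * \<alpha>\<^sup>2"
        using e by (simp add: pos_le_divide_eq)
      with \<alpha>(2) e show False by (simp add: algebra_simps)
    qed
  qed
qed

theorem theorem3p10:
  fixes B X :: "'a::banach set"
    and f \<psi> :: "'a \<Rightarrow> real"
    and ell :: "real \<Rightarrow> real"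
    and xs :: 'a
    and x y :: "nat \<Rightarrow> 'a"
    and G L \<eta> :: real
  assumes basis: "finite B" "independent B" "span B = UNIV"
    and X: "open X" "convex X"
    and f_convex: "convex_on X f"
    and f_closed: "\<And>a. closed {z \<in> X. f z \<le> a}"
    and ell_cont: "continuous_on {0..} ell"
    and ell_mono: "mono_on {0..} ell"
    and ell_pos: "\<And>a. 0 \<le> a \<Longrightarrow> 0 < ell a"
    and ell_subquadratic: "filterlim (\<lambda>\<alpha>. \<alpha>\<^sup>2 / ell \<alpha>) at_top at_top"
    and f_smooth: "ell_smooth B X ell f"
    and psi: "mirror_map X \<psi>"
    and xs: "is_arg_min f (\<lambda>z. z \<in> X) xs"
    and x0: "is_arg_min \<psi> (\<lambda>z. z \<in> X) (x 0)"
    and y0: "y 0 = x 0"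
    and G: "G = Sup {\<alpha>. 0 \<le> \<alpha> \<and> \<alpha>\<^sup>2 \<le> 2 * ell (2 * \<alpha>) * (f (x 0) - f xs)}"
    and L: "L = ell (2 * G)"
    and eta: "0 < \<eta>" "\<eta> \<le> 1 / (2 * L)"
    and y_step: "\<And>t. t \<ge> 1 \<Longrightarrow> y t \<in> prox X \<psi> (x (t - 1)) (\<eta> *\<^sub>R grad f (x (t - 1)))"
    and x_step: "\<And>t. t \<ge> 1 \<Longrightarrow> x t \<in> prox X \<psi> (x (t - 1)) (\<eta> *\<^sub>R grad f (y t))"
  shows "(\<forall>t. max (norm (grad f (y t))) (norm (grad f (x t))) \<le> G) \<and>
         (\<forall>T\<ge>1. f ((1 / real T) *\<^sub>R (\<Sum>t=1..T. y t)) - f xs \<le> bregman \<psi> xs (x 0) / (\<eta> * real T))"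
proof -
  interpret mirror_prox B X f ell \<psi>
    by unfold_locales (use assms in auto)
  have xs_X: "xs \<in> X" and xs_le: "\<And>z. z \<in> X \<Longrightarrow> f xs \<le> f z"
    using xs by (auto simp: is_arg_min_linorder)
  \<comment> \<open>The norm itself is a member of the set under \<open>Sup\<close>, once the gap at
    \<open>z\<close> is enlarged to the gap at \<open>x 0\<close>.\<close>
  have grad_le: "norm (grad f z) \<le> G" if z: "z \<in> X" "f z \<le> f (x 0)" for z
  proof -
    let ?a = "norm (grad f z)"
    have "?a\<^sup>2 \<le> 2 * ell (2 * ?a) * (f z - f xs)"
      using z(1) xs_le by (rule norm_grad_sq_le_gap)
    also have "\<dots> \<le> 2 * ell (2 * ?a) * (f (x 0) - f xs)"
      using z(2) ell_pos[of "2 * ?a"] by (intro mult_left_mono) auto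
    finally show ?thesis
      unfolding G by (intro cSup_upper bdd_above_subquadratic ell_pos ell_subquadratic) auto
  qed
  have x0D: "x 0 \<in> D" by (rule argmin_in_D[OF x0])
  have "0 \<le> G" using grad_le[of "x 0"] D_in_X[OF x0D] norm_ge_zero order_trans by blast
  then have "0 < L" using ell_pos by (simp add: L)
  with eta have \<eta>L: "\<eta> * (2 * ell (2 * G)) \<le> 1"
    by (simp add: L pos_le_divide_eq)
  note step = mirror_prox_step[OF _ _ eta(1) \<eta>L]
  \<comment> \<open>Descent keeps the sublevel set of the current iterate inside that of
    \<open>x 0\<close>, so the same \<open>G\<close> serves every step.\<close>
  have inv: "x t \<in> D \<and> f (x t) \<le> f (x 0)" for t
  proof (induction t)
    case (Suc t)
    have Gt: "norm (grad f z) \<le> G" if "z \<in> X" "f z \<le> f (x t)" for z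
      using grad_le that Suc.IH by simp
    have "y (Suc t) \<in> prox X \<psi> (x t) (\<eta> *\<^sub>R grad f (x t))" "x (Suc t) \<in> prox X \<psi> (x t) (\<eta> *\<^sub>R grad f (y (Suc t)))"
      using y_step[of "Suc t"] x_step[of "Suc t"] by auto
    from step(2,4)[OF _ Gt this xs_X] Suc.IH show ?case by auto
  qed (use x0D in simp)
  have iter: "y (Suc t) \<in> D" "f (y (Suc t)) \<le> f (x 0)"
    "\<eta> * (f (y (Suc t)) - f xs) \<le> bregman \<psi> xs (x t) - bregman \<psi> xs (x (Suc t))" for t
  proof -
    have Gt: "norm (grad f z) \<le> G" if "z \<in> X" "f z \<le> f (x t)" for z
      using grad_le that inv[of t] by simp
    have *: "y (Suc t) \<in> prox X \<psi> (x t) (\<eta> *\<^sub>R grad f (x t))" "x (Suc t) \<in> prox X \<psi> (x t) (\<eta> *\<^sub>R grad f (y (Suc t)))"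
      using y_step[of "Suc t"] x_step[of "Suc t"] by auto
    from step(1,3,5)[OF _ Gt * xs_X] inv[of t]
    show "y (Suc t) \<in> D" "f (y (Suc t)) \<le> f (x 0)"
      "\<eta> * (f (y (Suc t)) - f xs) \<le> bregman \<psi> xs (x t) - bregman \<psi> xs (x (Suc t))"
      by auto
  qed
  have "max (norm (grad f (y t))) (norm (grad f (x t))) \<le> G" for t
  proof -
    have "norm (grad f (x t)) \<le> G" using grad_le inv D_in_X by blast
    moreover have "norm (grad f (y t)) \<le> G"
    proof (cases t)
      case 0
      then show ?thesis using y0 grad_le[of "x 0"] D_in_X[OF x0D] by simp
    next
      case (Suc n)
      then show ?thesis using grad_le iter D_in_X by blast
    qed
    ultimately show ?thesis by simp
  qed
  moreover have "f ((1 / real T) *\<^sub>R (\<Sum>t=1..T. y t)) - f xs \<le> bregman \<psi> xs (x 0) / (\<eta> * real T)"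
    if T: "T \<ge> 1" for T
  proof -
    \<comment> \<open>\<open>y (Suc t)\<close> is paired with \<open>x t\<close> and
      \<open>x (Suc t)\<close>, so the Bregman terms telescope; the last one is dropped below by
      \<open>bregman_nonneg\<close>.\<close>
    have tele: "\<eta> * (\<Sum>t=1..n. f (y t) - f xs) \<le> bregman \<psi> xs (x 0) - bregman \<psi> xs (x n)" for n
    proof (induction n)
      case (Suc n)
      then show ?case using iter(3)[of n] by (simp add: distrib_left)
    qed simp
    have yX: "y t \<in> X" if "t \<in> {1..T}" for t
      using iter(1)[of "t - 1"] that D_in_X by simp
    have "f ((1 / real T) *\<^sub>R (\<Sum>t=1..T. y t)) = f (\<Sum>t=1..T. (1 / real T) *\<^sub>R y t)"
      by (simp add: scaleR_sum_right)
    also have "\<dots> \<le> (\<Sum>t=1..T. (1 / real T) * f (y t))"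
      using T yX by (intro convex_on_sum[OF _ _ f_convex]) auto
    also have "\<dots> = (\<Sum>t=1..T. f (y t) - f xs) / real T + f xs"
      using T by (simp add: sum_subtractf diff_divide_distrib flip: sum_divide_distrib)
    finally have "f ((1 / real T) *\<^sub>R (\<Sum>t=1..T. y t)) - f xs \<le> (\<Sum>t=1..T. f (y t) - f xs) / real T"
      by simp
    also have "\<dots> = \<eta> * (\<Sum>t=1..T. f (y t) - f xs) / (\<eta> * real T)"
      using eta(1) by simp
    also have "\<dots> \<le> bregman \<psi> xs (x 0) / (\<eta> * real T)"
      using tele[of T] bregman_nonneg[of "x T" xs] inv[of T] xs_X eta(1)
      by (intro divide_right_mono) auto
    finally show ?thesis .
  qed
  ultimately show ?thesis by blast
qed

end
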